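(* Let $S\subset\mathbb{R}^3$ be a rational ruled surface properly parametrized by $\boldsymbol{x}(t,s)=\boldsymbol{p}(t)+s\cdot\boldsymbol{q}(t)$, where $\boldsymbol{q}(t)=(q_1(t),q_2(t),q_3(t))$ with $q_i(t)\in\mathbb{R}[t]$ and $\gcd(q_1,q_2,q_3)=1$, and assume that $S$ is not doubly ruled, not cylindrical, and not a surface of revolution. Let $n=\max\{\deg q_1,\deg q_2,\deg q_3\}$. Let $f(\mathbf{x})=\boldsymbol{Q}\mathbf{x}+\boldsymbol{b}$ be an involution of $S$, i.e. a symmetry of $S$ with $f\circ f=\mathrm{id}_{\mathbb{R}^3}$, and let $\varphi:\mathbb{R}^2\dashrightarrow\mathbb{R}^2$ be the birational transformation such that $f\circ\boldsymbol{x}=\boldsymbol{x}\circ\varphi$. Then $$\varphi(t,s)=\bigl(\psi(t),\;k\cdot(\gamma t+\delta)^n\cdot s+c(t)\bigr),\qquad \psi(t)=\frac{\alpha t+\beta}{\gamma t+\delta},\quad \alpha\delta-\beta\gamma\neq0,$$ with $\alpha,\beta,\gamma,\delta,k$ real constants and $c(t)$ a rational function, and one of the following holds: (I) $\alpha=-\delta$ and $k^2(\gamma\beta+\delta^2)^n=1$; or (II) $\beta=\gamma=0$, $k^2\delta^{2n}=1$, and $\alpha=\delta\neq0$.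
   Context: $\boldsymbol{p}(t)$ is a triple of real rational functions of $t$. The surface $S\subset\mathbb{R}^3$ is the irreducible real algebraic surface (Zariski closure of the image) parametrized by $\boldsymbol{x}$. The parametrization is proper if $\boldsymbol{x}:\mathbb{R}^2\dashrightarrow S$ is birational, i.e. it has a rational inverse. The rulings of $S$ are the lines $s\mapsto\boldsymbol{x}(t_0,s)$. $S$ is doubly ruled if there are two different families of rulings contained in $S$ (the doubly ruled surfaces are the plane, the hyperbolic paraboloid and the single-sheeted hyperboloid). $S$ is cylindrical if $\boldsymbol{q}(t)$ is a multiple of a constant vector. An isometry of $\mathbb{R}^3$ is a map $f(\mathbf{x})=\boldsymbol{Q}\mathbf{x}+\boldsymbol{b}$ with $\boldsymbol{Q}$ a real orthogonal $3\times3$ matrix and $\boldsymbol{b}\in\mathbb{R}^3$; it is a symmetry of $S$ if $f(S)=S$. For each symmetry $f$ of $S$ there is a unique birational transformation $\varphi:\mathbb{R}^2\dashrightarrow\mathbb{R}^2$ (given by real rational functions) with $f(\boldsymbol{x}(t,s))=\boldsymbol{x}(\varphi(t,s))$ for generic $(t,s)$. *)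

theory Defs
  imports
    "HOL-Analysis.Analysis"
    "HOL-Computational_Algebra.Computational_Algebra"
    "HOL-Computational_Algebra.Field_as_Ring"
begin

definition zariski_closure :: "'a::real_normed_vector set \<Rightarrow> 'a set" where
  "zariski_closure A =
     {x. \<forall>g. real_polynomial_function g \<longrightarrow> (\<forall>a\<in>A. g a = 0) \<longrightarrow> g x = 0}"

text \<open>Generic points of \<open>V\<close>: all points of \<open>V\<close> off a proper Zariski closed subset of \<open>V\<close>.
  This and \<open>birational_on\<close> are meant for irreducible \<open>V\<close>. Below, \<open>V\<close> is either a whole space or
  the Zariski closure of the image of a rational map defined on one.\<close>

definition generically :: "'a::real_normed_vector set \<Rightarrow> ('a \<Rightarrow> bool) \<Rightarrow> bool" where
  "generically V P \<longleftrightarrow>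
     (\<exists>h. real_polynomial_function h \<and> (\<exists>v\<in>V. h v \<noteq> 0) \<and> (\<forall>v\<in>V. h v \<noteq> 0 \<longrightarrow> P v))"

text \<open>Rational maps are represented by total functions whose values off the domain of definition
  are irrelevant; identities between them are accordingly only asserted generically.
  \<open>rational_rep V \<phi> N D\<close> says that \<open>\<phi>\<close> is the rational map \<open>N / D\<close> on \<open>V\<close>.\<close>

definition rational_rep ::
  "'a::real_normed_vector set \<Rightarrow> ('a \<Rightarrow> 'b::real_normed_vector) \<Rightarrow> ('a \<Rightarrow> 'b) \<Rightarrow> ('a \<Rightarrow> real) \<Rightarrow> bool"
  where
  "rational_rep V \<phi> N D \<longleftrightarrow>
     polynomial_function N \<and> real_polynomial_function D \<and> (\<exists>v\<in>V. D v \<noteq> 0) \<and>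
     (\<forall>v\<in>V. D v \<noteq> 0 \<longrightarrow> \<phi> v = N v /\<^sub>R D v)"

text \<open>Besides being mutually inverse, \<open>\<phi>\<close> and \<open>\<eta>\<close> have to send generic points to points where the
  fraction representing the other one is defined, so that both compositions make sense as rational
  maps.\<close>

definition birational_on ::
  "'a::real_normed_vector set \<Rightarrow> 'b::real_normed_vector set \<Rightarrow> ('a \<Rightarrow> 'b) \<Rightarrow> bool" where
  "birational_on V W \<phi> \<longleftrightarrow>
     (\<exists>N D \<eta> M E. rational_rep V \<phi> N D \<and> rational_rep W \<eta> M E \<and>
        generically V (\<lambda>v. \<phi> v \<in> W \<and> E (\<phi> v) \<noteq> 0 \<and> \<eta> (\<phi> v) = v) \<and>
        generically W (\<lambda>w. \<eta> w \<in> V \<and> D (\<eta> w) \<noteq> 0 \<and> \<phi> (\<eta> w) = w))"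

text \<open>Univariate rational functions are elements of the fraction field of the polynomial ring;
  \<open>quot_of_fract\<close> yields numerator and denominator in lowest terms.\<close>

definition rf_defined :: "real poly fract \<Rightarrow> real \<Rightarrow> bool" where
  "rf_defined r t \<longleftrightarrow> poly (snd (quot_of_fract r)) t \<noteq> 0"

definition rf_eval :: "real poly fract \<Rightarrow> real \<Rightarrow> real" where
  "rf_eval r t = poly (fst (quot_of_fract r)) t / poly (snd (quot_of_fract r)) t"

definition ruled_map ::
  "real poly fract ^ 3 \<Rightarrow> real poly ^ 3 \<Rightarrow> real \<times> real \<Rightarrow> real ^ 3" where
  "ruled_map p q = (\<lambda>(t, s). (\<chi> i. rf_eval (p $ i) t) + s *\<^sub>R (\<chi> i. poly (q $ i) t))"

definition ruled_surface :: "real poly fract ^ 3 \<Rightarrow> real poly ^ 3 \<Rightarrow> (real ^ 3) set" where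
  "ruled_surface p q =
     zariski_closure (ruled_map p q ` {(t, s). \<forall>i. rf_defined (p $ i) t})"

text \<open>Irreducibility and dimension two of \<open>S\<close> need no separate clauses: \<open>S\<close> is the Zariski closure
  of the image of a rational map on the plane, and the plane is birational to it.\<close>

definition proper_ruled_parametrization ::
  "(real ^ 3) set \<Rightarrow> real poly fract ^ 3 \<Rightarrow> real poly ^ 3 \<Rightarrow> bool" where
  "proper_ruled_parametrization S p q \<longleftrightarrow>
     S = ruled_surface p q \<and> birational_on UNIV S (ruled_map p q)"

definition rulings :: "real poly fract ^ 3 \<Rightarrow> real poly ^ 3 \<Rightarrow> (real ^ 3) set set" where
  "rulings p q =
     {range (\<lambda>s. ruled_map p q (t, s)) | t.
        (\<forall>i. rf_defined (p $ i) t) \<and> (\<exists>i. poly (q $ i) t \<noteq> 0)}"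

text \<open>Families of rulings are irreducible algebraic curves of lines, so two different ones have only
  finitely many lines in common. The parametrizations are required to be proper because
  otherwise substituting, say, \<open>t\<^sup>2\<close> and \<open>-t\<^sup>2\<close> for \<open>t\<close> would split a single family into
  two almost disjoint parts.\<close>

definition doubly_ruled :: "(real ^ 3) set \<Rightarrow> bool" where
  "doubly_ruled S \<longleftrightarrow>
     (\<exists>p q p' q'. proper_ruled_parametrization S p q \<and> proper_ruled_parametrization S p' q' \<and>
        finite (rulings p q \<inter> rulings p' q'))"

definition cylindrical :: "real poly ^ 3 \<Rightarrow> bool" where
  "cylindrical q \<longleftrightarrow> (\<exists>g (v :: real ^ 3). \<forall>i. q $ i = smult (v $ i) g)"

definition isometry_map :: "real ^ 3 ^ 3 \<Rightarrow> real ^ 3 \<Rightarrow> real ^ 3 \<Rightarrow> real ^ 3" where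
  "isometry_map Q b = (\<lambda>x. Q *v x + b)"

definition symmetry_of :: "(real ^ 3) set \<Rightarrow> (real ^ 3 \<Rightarrow> real ^ 3) \<Rightarrow> bool" where
  "symmetry_of S f \<longleftrightarrow> (\<exists>Q b. orthogonal_matrix Q \<and> f = isometry_map Q b) \<and> f ` S = S"

definition surface_of_revolution :: "(real ^ 3) set \<Rightarrow> bool" where
  "surface_of_revolution S \<longleftrightarrow>
     (\<exists>a u. u \<noteq> 0 \<and>
        (\<forall>Q b. orthogonal_matrix Q \<and> det Q = 1 \<and>
               (\<forall>r. isometry_map Q b (a + r *\<^sub>R u) = a + r *\<^sub>R u) \<longrightarrow>
               isometry_map Q b ` S = S))"

end

theory Submission
  imports Defs
begin

text \<open>Since \<open>f \<circ> x\<close> is another proper ruled parametrization of \<open>S\<close> and \<open>S\<close> is not doubly ruled,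
  \<open>f\<close> maps infinitely many rulings to rulings. Hence the first component of \<open>\<phi>\<close> depends on \<open>t\<close>
  only, by a rational function \<open>\<psi>\<close>. From \<open>f \<circ> f = id\<close> and properness, \<open>\<phi> \<circ> \<phi> = id\<close>, so \<open>\<psi> \<circ> \<psi> = id\<close>
  and \<open>\<psi>\<close> is a Moebius transformation with \<open>\<alpha> = - \<delta>\<close>, or the identity. Differences of points on a
  ruling give that \<open>Q q(t)\<close> is parallel to \<open>q(\<psi>(t))\<close>, and homogenizing \<open>q\<close> in degree \<open>n\<close>,
  coprimality makes the factor a constant multiple of \<open>(\<gamma> t + \<delta>)\<^sup>n\<close>. Comparing the coefficients of
  \<open>s\<close> in \<open>\<phi> \<circ> \<phi> = id\<close> yields the condition on \<open>k\<close>.\<close>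

no_notation fps_nth (infixl \<open>$\<close> 75)

section \<open>Polynomial functions on the plane and generic points\<close>

lemma real_polynomial_function_poly_compose:
  assumes "real_polynomial_function f"
  shows "real_polynomial_function (\<lambda>v. poly p (f v))"
  by (induction p) (auto intro!: assms)

lemma real_polynomial_function_fst: "real_polynomial_function (fst :: real \<times> real \<Rightarrow> real)"
  and real_polynomial_function_snd: "real_polynomial_function (snd :: real \<times> real \<Rightarrow> real)"
  by (auto intro: bounded_linear_fst bounded_linear_snd)

lemma bounded_linear_compose_polynomial_function:
  "bounded_linear l \<Longrightarrow> polynomial_function N \<Longrightarrow> real_polynomial_function (\<lambda>v. l (N v))"
  by (simp add: polynomial_function_def o_def)

text \<open>A polynomial function on the plane, as a polynomial in \<open>s\<close> whose coefficients are polynomials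
  in \<open>t\<close>.\<close>

lemma real_polynomial_function_plane:
  fixes g :: "real \<times> real \<Rightarrow> real"
  assumes "real_polynomial_function g"
  shows "\<exists>P :: real poly poly. \<forall>t s. g (t, s) = poly (poly P [:s:]) t"
  using assms
proof (induction rule: real_polynomial_function.induct)
  case (linear f)
  interpret bounded_linear f by fact
  have "f (t, s) = poly (poly [: [:0, f (1, 0):], [:f (0, 1):] :] [:s:]) t" for t s
    using add[of "t *\<^sub>R (1, 0)" "s *\<^sub>R (0, 1)"] by (simp only: scale) simp
  then show ?case by blast
next
  case (const c)
  show ?case by (rule exI[of _ "[:[:c:]:]"]) simp
next
  case (add f g)
  then obtain P P' where "\<forall>t s. f (t, s) = poly (poly P [:s:]) t"
    "\<forall>t s. g (t, s) = poly (poly P' [:s:]) t" by blast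
  then show ?case by (intro exI[of _ "P + P'"]) simp
next
  case (mult f g)
  then obtain P P' where "\<forall>t s. f (t, s) = poly (poly P [:s:]) t"
    "\<forall>t s. g (t, s) = poly (poly P' [:s:]) t" by blast
  then show ?case by (intro exI[of _ "P * P'"]) simp
qed

lemma poly_poly_const:
  "poly (poly P [:s:]) t = poly (map_poly (\<lambda>c. poly c t) P) s" for s t :: real
  by (induction P) (auto simp: map_poly_pCons algebra_simps)

lemma MOST_real_ex: "MOST x :: real. P x \<Longrightarrow> \<exists>x. P x"
  using frequently_ex[OF MOST_INFM] infinite_UNIV_char_0 by blast

lemma MOST_poly_neq_0: "p \<noteq> 0 \<Longrightarrow> MOST x. poly p x \<noteq> 0" for p :: "real poly"
  by (simp add: MOST_iff_cofinite poly_roots_finite)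

lemma poly_eq_0_if_INFM: "INFM x. poly p x = 0 \<Longrightarrow> p = 0" for p :: "real poly"
  using poly_roots_finite[of p] by (auto simp: frequently_cofinite)

lemma poly_eq_if_MOST:
  fixes p q :: "real poly"
  assumes "MOST x. poly p x = poly q x"
  shows "p = q"
proof -
  have "INFM x. poly (p - q) x = 0"
    using MOST_INFM[OF infinite_UNIV_char_0 assms] by simp
  then show ?thesis using poly_eq_0_if_INFM by fastforce
qed

lemma poly_function_line_eq_0:
  fixes g :: "real \<times> real \<Rightarrow> real"
  assumes "real_polynomial_function g" "INFM s. g (t, s) = 0"
  shows "g (t, s) = 0"
proof -
  obtain P where P: "\<And>t s. g (t, s) = poly (poly P [:s:]) t"
    using real_polynomial_function_plane[OF assms(1)] by blast
  then have "map_poly (\<lambda>c. poly c t) P = 0"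
    using assms(2) by (intro poly_eq_0_if_INFM) (simp add: P poly_poly_const)
  then show ?thesis by (simp add: P poly_poly_const)
qed

text \<open>For infinitely many \<open>t\<close> the specialization of \<open>P\<close> at
  \<open>t\<close> is the zero polynomial in \<open>s\<close>, so each coefficient of
  \<open>P\<close>, a polynomial in \<open>t\<close>, has infinitely many roots.\<close>

lemma poly_function_plane_eq_0:
  fixes g :: "real \<times> real \<Rightarrow> real"
  assumes "real_polynomial_function g" "INFM t. INFM s. g (t, s) = 0"
  shows "g v = 0"
proof -
  obtain P where P: "\<And>t s. g (t, s) = poly (poly P [:s:]) t"
    using real_polynomial_function_plane[OF assms(1)] by blast
  have "INFM t. map_poly (\<lambda>c. poly c t) P = 0"
    using assms(2) by (rule frequently_elim1) (auto simp: P poly_poly_const intro: poly_eq_0_if_INFM)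
  then have "INFM t. poly (coeff P i) t = 0" for i
    by (rule frequently_elim1) (metis coeff_0 coeff_map_poly poly_0)
  then have "coeff P i = 0" for i by (rule poly_eq_0_if_INFM)
  then have "P = 0" by (simp add: poly_eq_iff)
  then show ?thesis by (cases v) (simp add: P)
qed

text \<open>The second part fixes one \<open>s\<close> for almost all \<open>t\<close>. Restricted
  to such a line, numerators and denominators become univariate polynomials.\<close>

lemma MOST_MOST_poly_function_neq_0:
  fixes g :: "real \<times> real \<Rightarrow> real"
  assumes "real_polynomial_function g" "g v \<noteq> 0"
  shows "MOST t. MOST s. g (t, s) \<noteq> 0" and "\<exists>s. MOST t. g (t, s) \<noteq> 0"
proof -
  obtain P where P: "\<And>t s. g (t, s) = poly (poly P [:s:]) t"
    using real_polynomial_function_plane[OF assms(1)] by blast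
  have "MOST t. \<not> (INFM s. g (t, s) = 0)"
  proof (rule ccontr)
    assume "\<not> ?thesis"
    then have "INFM t. INFM s. g (t, s) = 0" by simp
    then show False using poly_function_plane_eq_0 assms by blast
  qed
  then show "MOST t. MOST s. g (t, s) \<noteq> 0" by simp
  have "poly P [:snd v:] \<noteq> 0" using assms(2) P[of "fst v" "snd v"] by auto
  then show "\<exists>s. MOST t. g (t, s) \<noteq> 0" using MOST_poly_neq_0 by (auto simp: P)
qed

lemma generically_planeD:
  assumes "generically UNIV (P :: real \<times> real \<Rightarrow> bool)"
  shows "MOST t. MOST s. P (t, s)" and "\<exists>s. MOST t. P (t, s)"
proof -
  obtain h v where h: "real_polynomial_function h" "h v \<noteq> 0" "\<And>v. h v \<noteq> 0 \<Longrightarrow> P v"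
    using assms by (auto simp: generically_def)
  show "MOST t. MOST s. P (t, s)"
    using MOST_MOST_poly_function_neq_0(1)[OF h(1,2)] by (auto elim!: eventually_mono intro: h(3))
  show "\<exists>s. MOST t. P (t, s)"
    using MOST_MOST_poly_function_neq_0(2)[OF h(1,2)] by (auto elim!: eventually_mono intro: h(3))
qed

text \<open>Irreducibility of the plane: two nonempty Zariski open sets meet. This makes generic
  properties closed under conjunction.\<close>

lemma real_polynomial_function_mult_neq_0:
  fixes g h :: "real \<times> real \<Rightarrow> real"
  assumes "real_polynomial_function g" "g v \<noteq> 0" "real_polynomial_function h" "h w \<noteq> 0"
  shows "\<exists>u. g u * h u \<noteq> 0"
proof -
  have "MOST t. MOST s. g (t, s) * h (t, s) \<noteq> 0"
    using MOST_MOST_poly_function_neq_0(1)[OF assms(1,2)] MOST_MOST_poly_function_neq_0(1)[OF assms(3,4)]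
    by eventually_elim (erule (1) eventually_elim2, simp)
  then obtain t where "MOST s. g (t, s) * h (t, s) \<noteq> 0" by (blast dest: MOST_real_ex)
  then show ?thesis by (blast dest: MOST_real_ex)
qed

lemma generically_mono: "generically V P \<Longrightarrow> (\<And>v. v \<in> V \<Longrightarrow> P v \<Longrightarrow> Q v) \<Longrightarrow> generically V Q"
  unfolding generically_def by blast

lemma generically_plane_conj:
  assumes "generically UNIV (P :: real \<times> real \<Rightarrow> bool)" "generically UNIV Q"
  shows "generically UNIV (\<lambda>v. P v \<and> Q v)"
proof -
  obtain g v h w where *: "real_polynomial_function g" "g v \<noteq> 0" "\<And>v. g v \<noteq> 0 \<Longrightarrow> P v"
    "real_polynomial_function h" "h w \<noteq> 0" "\<And>v. h v \<noteq> 0 \<Longrightarrow> Q v"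
    using assms by (auto simp: generically_def)
  obtain u where "g u * h u \<noteq> 0" using real_polynomial_function_mult_neq_0[OF *(1,2,4,5)] by blast
  then show ?thesis unfolding generically_def
    by (intro exI[of _ "\<lambda>v. g v * h v"] conjI bexI[of _ u] ballI impI
        real_polynomial_function.intros(4) *)
      auto
qed

lemma generically_poly_function_neq_0:
  "real_polynomial_function h \<Longrightarrow> h v \<noteq> 0 \<Longrightarrow> generically UNIV (\<lambda>v. h v \<noteq> 0)"
  unfolding generically_def by blast

lemma generically_planeE:
  assumes "generically UNIV (P :: real \<times> real \<Rightarrow> bool)"
  obtains v where "P v"
  using assms by (auto simp: generically_def)

lemma poly_function_plane_eq_0_if_generically:
  fixes g :: "real \<times> real \<Rightarrow> real"
  assumes "real_polynomial_function g" "generically UNIV (\<lambda>v. g v = 0)"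
  shows "g v = 0"
proof (rule ccontr)
  assume "g v \<noteq> 0"
  from generically_plane_conj[OF assms(2) generically_poly_function_neq_0[OF assms(1) this]]
  show False by (auto elim: generically_planeE)
qed

text \<open>Used to pull polynomials back along a rational map. Denominators are cleared by
  induction on \<open>h\<close>; a power of \<open>D\<close> is needed because products multiply
  denominators.\<close>

lemma poly_function_of_fraction:
  assumes "real_polynomial_function h" "polynomial_function N" "real_polynomial_function D"
  shows "\<exists>H m. real_polynomial_function H \<and> (\<forall>v. D v \<noteq> 0 \<longrightarrow> h (N v /\<^sub>R D v) = H v / D v ^ m)"
  using assms(1)
proof (induction rule: real_polynomial_function.induct)
  case (linear f)
  show ?case
    by (intro exI[of _ "\<lambda>v. f (N v)"] exI[of _ 1])
      (simp add: linear assms bounded_linear_compose_polynomial_function linear_scale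
        bounded_linear.linear divide_inverse mult.commute)
next
  case (const c)
  show ?case by (intro exI[of _ "\<lambda>_. c"] exI[of _ 0]) auto
next
  case (add f g)
  then obtain F G m n where
    *: "real_polynomial_function F" "\<forall>v. D v \<noteq> 0 \<longrightarrow> f (N v /\<^sub>R D v) = F v / D v ^ m"
    "real_polynomial_function G" "\<forall>v. D v \<noteq> 0 \<longrightarrow> g (N v /\<^sub>R D v) = G v / D v ^ n" by blast
  show ?case
    by (intro exI[of _ "\<lambda>v. F v * D v ^ n + G v * D v ^ m"] exI[of _ "m + n"])
      (use * assms(3) in \<open>auto intro!: real_polynomial_function_power simp: field_simps power_add\<close>)
next
  case (mult f g)
  then obtain F G m n where
    *: "real_polynomial_function F" "\<forall>v. D v \<noteq> 0 \<longrightarrow> f (N v /\<^sub>R D v) = F v / D v ^ m"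
    "real_polynomial_function G" "\<forall>v. D v \<noteq> 0 \<longrightarrow> g (N v /\<^sub>R D v) = G v / D v ^ n" by blast
  show ?case
    by (intro exI[of _ "\<lambda>v. F v * G v"] exI[of _ "m + n"])
      (use * in \<open>auto simp: field_simps power_add\<close>)
qed

text \<open>Birational transformations are dominant: a polynomial vanishing after the substitution of
  \<open>\<phi>\<close> also vanishes after substituting the inverse of \<open>\<phi>\<close> into \<open>\<phi>\<close>.\<close>

lemma generically_compose_birational:
  fixes \<phi> :: "real \<times> real \<Rightarrow> real \<times> real"
  assumes "birational_on UNIV UNIV \<phi>" "generically UNIV P"
  shows "generically UNIV (\<lambda>v. P (\<phi> v))"
proof -
  obtain N D \<eta> where rep: "rational_rep UNIV \<phi> N D"
    and inv: "generically UNIV (\<lambda>w. D (\<eta> w) \<noteq> 0 \<and> \<phi> (\<eta> w) = w)"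
    using assms(1) unfolding birational_on_def by auto
  have N: "polynomial_function N" and D: "real_polynomial_function D"
    and eq: "\<And>v. D v \<noteq> 0 \<Longrightarrow> \<phi> v = N v /\<^sub>R D v"
    using rep by (auto simp: rational_rep_def)
  obtain h v0 where h: "real_polynomial_function h" "h v0 \<noteq> 0" "\<And>v. h v \<noteq> 0 \<Longrightarrow> P v"
    using assms(2) by (auto simp: generically_def)
  obtain H m where H: "real_polynomial_function H"
    "\<And>v. D v \<noteq> 0 \<Longrightarrow> h (N v /\<^sub>R D v) = H v / D v ^ m"
    using poly_function_of_fraction[OF h(1) N D] by blast
  \<comment> \<open>The point \<open>\<eta> w\<close> witnesses that the numerator \<open>H\<close>
    of the pullback is not identically zero, since \<open>h\<close> does not vanish at its image
    \<open>w\<close>.\<close>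
  obtain w where w: "D (\<eta> w) \<noteq> 0" "\<phi> (\<eta> w) = w" "h w \<noteq> 0"
    using generically_plane_conj[OF inv generically_poly_function_neq_0[OF h(1,2)]]
    by (auto elim: generically_planeE)
  then have "H (\<eta> w) \<noteq> 0" using H(2)[of "\<eta> w"] eq[of "\<eta> w"] by auto
  from generically_plane_conj[OF generically_poly_function_neq_0[OF H(1) this]
      generically_poly_function_neq_0[OF D w(1)]]
  show ?thesis by (rule generically_mono) (auto intro!: h(3) simp: eq H(2))
qed

section \<open>Evaluation of univariate rational functions, and images of ruled parametrizations
  under isometries\<close>

lemma rf_Fract:
  assumes "poly d t \<noteq> 0"
  shows "rf_defined (Fract a d) t" "rf_eval (Fract a d) t = poly a t / poly d t"
proof -
  have "d \<noteq> 0" using assms by auto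
  then have *: "quot_of_fract (Fract a d) = normalize_quot (a, d)"
    using quot_of_fract_quot_to_fract[of "(a, d)"] by (simp add: quot_to_fract_def)
  \<comment> \<open>Reduction to lowest terms cancels a common factor \<open>e\<close>, which cannot
    vanish at \<open>t\<close> because it divides \<open>d\<close>.\<close>
  obtain e where "a = fst (normalize_quot (a, d)) * e" "d = snd (normalize_quot (a, d)) * e"
    using normalize_quotE[OF \<open>d \<noteq> 0\<close>] by metis
  then have "poly a t = poly (fst (normalize_quot (a, d))) t * poly e t"
    "poly d t = poly (snd (normalize_quot (a, d))) t * poly e t"
    by (metis poly_mult)+
  then show "rf_defined (Fract a d) t" "rf_eval (Fract a d) t = poly a t / poly d t"
    using assms by (auto simp: rf_defined_def rf_eval_def *)
qed

lemma rf_add: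
  assumes "rf_defined r t" "rf_defined r' t"
  shows "rf_defined (r + r') t" "rf_eval (r + r') t = rf_eval r t + rf_eval r' t"
proof -
  define a d a' d' where defs: "a = fst (quot_of_fract r)" "d = snd (quot_of_fract r)"
    "a' = fst (quot_of_fract r')" "d' = snd (quot_of_fract r')"
  have d: "poly d t \<noteq> 0" "poly d' t \<noteq> 0" using assms by (auto simp: rf_defined_def defs)
  then have "d \<noteq> 0" "d' \<noteq> 0" by auto
  then have r: "r + r' = Fract (a * d' + a' * d) (d * d')"
    using add_fract[of d d' a a'] by (simp add: defs)
  show "rf_defined (r + r') t" "rf_eval (r + r') t = rf_eval r t + rf_eval r' t"
    using d rf_Fract[of "d * d'" t "a * d' + a' * d"]
    unfolding r by (simp_all add: rf_eval_def defs[symmetric] add_frac_eq)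
qed

lemma rf_const: "rf_defined (Fract [:c:] 1) t" "rf_eval (Fract [:c:] 1) t = c"
  using rf_Fract[of 1 t "[:c:]"] by auto

lemma rf_const_mult:
  assumes "rf_defined r t"
  shows "rf_defined (Fract [:c:] 1 * r) t" "rf_eval (Fract [:c:] 1 * r) t = c * rf_eval r t"
proof -
  define a d where defs: "a = fst (quot_of_fract r)" "d = snd (quot_of_fract r)"
  have d: "poly d t \<noteq> 0" using assms by (auto simp: rf_defined_def defs)
  have r: "Fract [:c:] 1 * r = Fract (smult c a) d"
    using Fract_quot_of_fract[of r] mult_fract[of "[:c:]" 1 a d] by (simp add: defs)
  show "rf_defined (Fract [:c:] 1 * r) t" "rf_eval (Fract [:c:] 1 * r) t = c * rf_eval r t"
    using d rf_Fract[of d t "smult c a"] by (simp_all add: r) (simp add: rf_eval_def defs)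
qed

lemma rf_sum:
  assumes "finite A" "\<And>i. i \<in> A \<Longrightarrow> rf_defined (r i) t"
  shows "rf_defined (\<Sum>i\<in>A. r i) t \<and> rf_eval (\<Sum>i\<in>A. r i) t = (\<Sum>i\<in>A. rf_eval (r i) t)"
  using assms
proof (induction A rule: finite_induct)
  case empty
  show ?case using rf_const[of 0 t] by (simp add: fract_collapse)
next
  case (insert i A)
  then show ?case by (simp add: rf_add)
qed

text \<open>\<open>doubly_ruled\<close> quantifies over formal data, so the parametrization
  \<open>f \<circ> x\<close> has to be given by elements of the fraction field, not merely as a
  composed function.\<close>

definition affine_rf :: "real ^ 3 ^ 3 \<Rightarrow> real ^ 3 \<Rightarrow> real poly fract ^ 3 \<Rightarrow> real poly fract ^ 3" where
  "affine_rf Q b p = (\<chi> i. (\<Sum>j\<in>UNIV. Fract [:Q $ i $ j:] 1 * p $ j) + Fract [:b $ i:] 1)"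

definition linear_poly :: "real ^ 3 ^ 3 \<Rightarrow> real poly ^ 3 \<Rightarrow> real poly ^ 3" where
  "linear_poly Q q = (\<chi> i. \<Sum>j\<in>UNIV. smult (Q $ i $ j) (q $ j))"

lemma linear_poly_eval:
  "(\<chi> i. poly (linear_poly Q q $ i) t) = Q *v (\<chi> i. poly (q $ i) t)"
  by (simp add: vec_eq_iff linear_poly_def poly_sum matrix_vector_mult_def)

lemma affine_rf_eval:
  fixes p :: "real poly fract ^ 3"
  assumes "\<And>i. rf_defined (p $ i) t"
  shows "rf_defined (affine_rf Q b p $ i) t"
    and "(\<chi> i. rf_eval (affine_rf Q b p $ i) t) = isometry_map Q b (\<chi> i. rf_eval (p $ i) t)"
proof -
  have *: "rf_defined (\<Sum>j\<in>UNIV. Fract [:Q $ i $ j:] 1 * p $ j) t \<and>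
    rf_eval (\<Sum>j\<in>UNIV. Fract [:Q $ i $ j:] 1 * p $ j) t = (\<Sum>j\<in>UNIV. Q $ i $ j * rf_eval (p $ j) t)" for i
    using rf_sum[of UNIV "\<lambda>j. Fract [:Q $ i $ j:] 1 * p $ j" t] by (simp add: rf_const_mult assms)
  show "rf_defined (affine_rf Q b p $ i) t"
    using * by (simp add: affine_rf_def rf_add rf_const)
  show "(\<chi> i. rf_eval (affine_rf Q b p $ i) t) = isometry_map Q b (\<chi> i. rf_eval (p $ i) t)"
    using * by (simp add: vec_eq_iff affine_rf_def rf_add rf_const isometry_map_def matrix_vector_mult_def)
qed

text \<open>The functional equation yields the scalar identities for \<open>Q ** Q = mat 1\<close>
  and \<open>Q *v b + b = 0\<close>. Embedding constants into the fraction field is a homomorphism,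
  so these identities also hold for rational functions, without reference to values or
  poles.\<close>

lemma affine_rf_involution:
  assumes "isometry_map Q b \<circ> isometry_map Q b = id"
  shows "affine_rf Q b (affine_rf Q b p) = p"
proof -
  have eq: "Q *v (Q *v x + b) + b = x" for x
    using fun_cong[OF assms, of x] by (simp add: isometry_map_def)
  have b: "(\<Sum>j\<in>UNIV. Q $ i $ j * b $ j) + b $ i = 0" for i
    using arg_cong[OF eq[of 0], of "\<lambda>v. v $ i"] by (simp add: matrix_vector_mult_def)
  have "Q ** Q = mat 1"
    using eq eq[of 0] by (simp add: matrix_eq matrix_vector_mul_assoc[symmetric] matrix_vector_right_distrib)
      (metis add.assoc add_cancel_right_right)
  then have Q: "(\<Sum>j\<in>UNIV. Q $ i $ j * Q $ j $ k) = (if i = k then 1 else 0)" for i k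
  proof -
    have "(Q ** Q) $ i $ k = mat 1 $ i $ k" by (simp only: \<open>Q ** Q = mat 1\<close>)
    then show ?thesis by (simp add: mat_def matrix_matrix_mult_def)
  qed
  have hom: "Fract [:x:] 1 * Fract [:y:] 1 = (Fract [:x * y:] 1 :: real poly fract)"
    "Fract [:x:] 1 + Fract [:y:] 1 = (Fract [:x + y:] 1 :: real poly fract)" for x y
    by (simp_all add: mult.commute)
  have hom_sum: "(\<Sum>j\<in>A. Fract [:g j:] 1) = (Fract [:\<Sum>j\<in>A. g j:] 1 :: real poly fract)"
    if "finite A" for A :: "3 set" and g
    using that by induction (simp_all add: fract_collapse hom)
  have "affine_rf Q b (affine_rf Q b p) $ i = p $ i" for i
  proof -
    have "affine_rf Q b (affine_rf Q b p) $ i =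
      (\<Sum>j\<in>UNIV. \<Sum>k\<in>UNIV. Fract [:Q $ i $ j * Q $ j $ k:] 1 * p $ k) +
      ((\<Sum>j\<in>UNIV. Fract [:Q $ i $ j * b $ j:] 1) + Fract [:b $ i:] 1)"
      by (simp add: affine_rf_def distrib_left sum.distrib sum_distrib_left mult.assoc[symmetric]
          add.assoc hom(1) del: mult_fract)
    also have "(\<Sum>j\<in>UNIV. \<Sum>k\<in>UNIV. Fract [:Q $ i $ j * Q $ j $ k:] 1 * p $ k) =
      (\<Sum>k\<in>UNIV. Fract [:\<Sum>j\<in>UNIV. Q $ i $ j * Q $ j $ k:] 1 * p $ k)"
      by (subst sum.swap) (simp add: hom_sum flip: sum_distrib_right)
    also have "\<dots> = (\<Sum>k\<in>UNIV. if i = k then p $ k else 0)"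
      by (rule sum.cong) (auto simp: Q fract_collapse simp flip: one_pCons)
    also have "(\<Sum>j\<in>UNIV. Fract [:Q $ i $ j * b $ j:] 1) + Fract [:b $ i:] 1 = (0 :: real poly fract)"
      by (simp only: hom_sum[OF finite] hom b) (simp add: fract_collapse)
    finally show ?thesis by simp
  qed
  then show ?thesis by (simp add: vec_eq_iff)
qed

lemma ruled_map_affine:
  fixes p :: "real poly fract ^ 3"
  assumes "\<And>i. rf_defined (p $ i) t"
  shows "ruled_map (affine_rf Q b p) (linear_poly Q q) (t, s) = isometry_map Q b (ruled_map p q (t, s))"
  by (simp add: ruled_map_def linear_poly_eval affine_rf_eval(2)[OF assms] isometry_map_def
      matrix_vector_right_distrib matrix_vector_mult_scaleR)

lemma polynomial_function_isometry_map: "polynomial_function (isometry_map Q b)"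
  unfolding isometry_map_def
  by (intro polynomial_function_add polynomial_function_const polynomial_function_bounded_linear
      matrix_vector_mul_bounded_linear)

lemma zariski_closure_involution:
  assumes "polynomial_function f" "f \<circ> f = id"
  shows "zariski_closure (f ` A) = f ` zariski_closure A"
proof -
  have ff: "f (f x) = x" for x using fun_cong[OF assms(2), of x] by simp
  have sub: "f ` zariski_closure B \<subseteq> zariski_closure (f ` B)" for B
    using real_polynomial_function_compose[OF assms(1)] by (fastforce simp: zariski_closure_def o_def)
  have "f ` f ` B = B" for B by (simp add: image_comp assms(2))
  then show ?thesis using sub[of A] sub[of "f ` A"] by (metis image_mono subset_antisym)
qed

text \<open>\<open>rf_eval\<close> takes the junk value 0 at a pole, so the representation of the parametrization could
  a priori agree with it there. It cannot, since \<open>N / D\<close> is finite where \<open>D\<close> does not vanish.\<close>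

lemma rational_rep_ruled_map_defined:
  fixes p :: "real poly fract ^ 3"
  assumes "rational_rep UNIV (ruled_map p q) N D" "D (t, s) \<noteq> 0"
  shows "rf_defined (p $ i) t"
proof (rule ccontr)
  define a d where defs: "a = fst (quot_of_fract (p $ i))" "d = snd (quot_of_fract (p $ i))"
  assume "\<not> ?thesis"
  then have d: "poly d t = 0" by (simp add: rf_defined_def defs)
  have "coprime a d" by (simp add: defs coprime_quot_of_fract)
  then have a: "poly a t \<noteq> 0"
    using d by (metis coprime_common_divisor poly_eq_0_iff_dvd is_unit_pCons_iff pCons_eq_0_iff one_neq_zero)
  have N: "polynomial_function N" and D: "real_polynomial_function D"
    and eq: "\<And>v. D v \<noteq> 0 \<Longrightarrow> ruled_map p q v = N v /\<^sub>R D v"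
    using assms(1) by (auto simp: rational_rep_def)
  note [intro] = real_polynomial_function_fst real_polynomial_function_snd
    real_polynomial_function_poly_compose
  \<comment> \<open>Component \<open>i\<close> of the equation between the parametrization and
    \<open>N / D\<close>, with denominators cleared. At a root of \<open>d\<close> only the product
    of \<open>a\<close> and \<open>D\<close> survives, and neither factor vanishes there.\<close>
  define g where "g = (\<lambda>v. poly a (fst v) * D v
    + snd v * poly (q $ i) (fst v) * poly d (fst v) * D v - N v $ i * poly d (fst v))"
  have Ni: "real_polynomial_function (\<lambda>v. N v $ i)"
    using bounded_linear_compose_polynomial_function[OF bounded_linear_vec_nth N] .
  have g: "real_polynomial_function g"
    unfolding g_def by (intro real_polynomial_function_diff real_polynomial_function.intros(3,4) Ni D) auto
  have "d \<noteq> 0" by (simp add: defs)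
  then obtain t0 where "poly d t0 \<noteq> 0" using poly_all_0_iff_0 by blast
  then have "generically UNIV (\<lambda>v::real \<times> real. poly d (fst v) \<noteq> 0)"
    by (intro generically_poly_function_neq_0[where v = "(t0, 0)"]) auto
  from generically_plane_conj[OF this generically_poly_function_neq_0[OF D assms(2)]]
  have "generically UNIV (\<lambda>v. g v = 0)"
  proof (rule generically_mono, elim conjE)
    fix v assume v: "poly d (fst v) \<noteq> 0" "D v \<noteq> 0"
    have "N v $ i / D v = poly a (fst v) / poly d (fst v) + snd v * poly (q $ i) (fst v)"
      using arg_cong[OF eq[OF v(2)], of "\<lambda>x. x $ i"]
      by (simp add: ruled_map_def case_prod_unfold rf_eval_def defs divide_inverse mult.commute)
    then show "g v = 0" using v by (simp add: g_def field_simps)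
  qed
  then have "g (t, s) = 0" by (rule poly_function_plane_eq_0_if_generically[OF g])
  then show False using a d assms(2) by (simp add: g_def)
qed

text \<open>The parametrization \<open>f \<circ> x\<close> has numerator
  \<open>Q *v N + D *\<^sub>R b\<close> over the same denominator \<open>D\<close>, and its inverse
  is \<open>\<eta> \<circ> f\<close> because \<open>f\<close> is its own inverse.\<close>

lemma proper_ruled_parametrization_affine:
  fixes p :: "real poly fract ^ 3"
  assumes "proper_ruled_parametrization S p q" "f = isometry_map Q b" "f \<circ> f = id" "f ` S = S"
  shows "proper_ruled_parametrization S (affine_rf Q b p) (linear_poly Q q)"
proof -
  let ?x = "ruled_map p q" and ?x' = "ruled_map (affine_rf Q b p) (linear_poly Q q)"
  have ff: "f (f x) = x" for x using fun_cong[OF assms(3), of x] by simp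
  have fS: "f x \<in> S \<longleftrightarrow> x \<in> S" for x using assms(4) ff by (metis imageI)
  have poly_f: "polynomial_function f" using assms(2) polynomial_function_isometry_map by simp
  have inv: "affine_rf Q b (affine_rf Q b p) = p" using affine_rf_involution assms(2,3) by blast
  \<comment> \<open>The affine map creates no poles. Applied twice it returns \<open>p\<close>, so
    it removes none either.\<close>
  have def_iff: "(\<forall>i. rf_defined (affine_rf Q b p $ i) t) \<longleftrightarrow> (\<forall>i. rf_defined (p $ i) t)" for t
    using affine_rf_eval(1)[of p t Q b] affine_rf_eval(1)[of "affine_rf Q b p" t Q b] inv by auto
  have x': "?x' (t, s) = f (?x (t, s))" if "\<forall>i. rf_defined (p $ i) t" for t s
    using ruled_map_affine[of p t Q b q s] that assms(2) by simp
  have S: "S = ruled_surface p q" and bir: "birational_on UNIV S ?x"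
    using assms(1) by (auto simp: proper_ruled_parametrization_def)
  have "?x' ` {(t, s). \<forall>i. rf_defined (affine_rf Q b p $ i) t} =
      f ` ?x ` {(t, s). \<forall>i. rf_defined (p $ i) t}"
    unfolding image_image def_iff by (rule image_cong) (auto simp: x')
  then have surf: "S = ruled_surface (affine_rf Q b p) (linear_poly Q q)"
    using S assms(4) zariski_closure_involution[OF poly_f assms(3)] by (simp add: ruled_surface_def)
  obtain N D \<eta> M E where N: "rational_rep UNIV ?x N D" and M: "rational_rep S \<eta> M E"
    and gen: "generically UNIV (\<lambda>v. ?x v \<in> S \<and> E (?x v) \<noteq> 0 \<and> \<eta> (?x v) = v)"
    and gen_S: "generically S (\<lambda>w. D (\<eta> w) \<noteq> 0 \<and> ?x (\<eta> w) = w)"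
    using bir unfolding birational_on_def by auto
  have D: "real_polynomial_function D" "polynomial_function N" "\<And>v. D v \<noteq> 0 \<Longrightarrow> ?x v = N v /\<^sub>R D v"
    and "\<exists>v. D v \<noteq> 0"
    using N by (auto simp: rational_rep_def)
  then obtain v0 where v0: "D v0 \<noteq> 0" by blast
  \<comment> \<open>Where \<open>D\<close> does not vanish, \<open>p\<close> has no pole, so the
    default values of \<open>rf_eval\<close> do not interfere.\<close>
  have x'D: "?x' v = f (?x v)" if "D v \<noteq> 0" for v
    using rational_rep_ruled_map_defined[OF N] that x' by (cases v) blast
  have "rational_rep UNIV ?x' (\<lambda>v. Q *v N v + D v *\<^sub>R b) D"
    unfolding rational_rep_def
  proof (intro conjI ballI impI)
    have "polynomial_function ((\<lambda>x. Q *v x) \<circ> N)"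
      by (intro polynomial_function_compose polynomial_function_bounded_linear
          matrix_vector_mul_bounded_linear D)
    then show "polynomial_function (\<lambda>v. Q *v N v + D v *\<^sub>R b)"
      using D(1) by (intro polynomial_function_add polynomial_function_mult polynomial_function_const)
        (simp_all add: o_def real_polynomial_function_eq)
  next
    show "\<exists>v\<in>UNIV. D v \<noteq> 0" using v0 by blast
  qed (use D in \<open>auto simp: x'D assms(2) isometry_map_def scaleR_right_distrib
      matrix_vector_mult_scaleR\<close>)
  moreover have "rational_rep S (\<eta> \<circ> f) (M \<circ> f) (E \<circ> f)"
    using M poly_f fS ff unfolding rational_rep_def by (auto simp: ff) (metis fS ff)+
  moreover have "generically UNIV (\<lambda>v. ?x' v \<in> S \<and> (E \<circ> f) (?x' v) \<noteq> 0 \<and> (\<eta> \<circ> f) (?x' v) = v)"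
    using generically_plane_conj[OF gen generically_poly_function_neq_0[OF D(1) v0]]
    by (rule generically_mono) (auto simp: x'D fS ff)
  moreover have "generically S (\<lambda>w. (\<eta> \<circ> f) w \<in> UNIV \<and> D ((\<eta> \<circ> f) w) \<noteq> 0 \<and> ?x' ((\<eta> \<circ> f) w) = w)"
  proof -
    obtain h w where "real_polynomial_function h" "w \<in> S" "h w \<noteq> 0"
      "\<forall>v\<in>S. h v \<noteq> 0 \<longrightarrow> D (\<eta> v) \<noteq> 0 \<and> ?x (\<eta> v) = v"
      using gen_S unfolding generically_def by blast
    then show ?thesis unfolding generically_def
      using real_polynomial_function_compose[OF poly_f] fS ff
      by (intro exI[of _ "h \<circ> f"]) (auto simp: x'D intro!: bexI[of _ "f w"])
  qed
  ultimately show ?thesis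
    using surf unfolding proper_ruled_parametrization_def birational_on_def by blast
qed

section \<open>Homogenized substitution, Moebius involutions and direction vectors\<close>

definition homog_subst :: "nat \<Rightarrow> real poly \<Rightarrow> real poly \<Rightarrow> real poly \<Rightarrow> real poly" where
  "homog_subst n r a d = (\<Sum>i\<le>n. smult (coeff r i) (a ^ i * d ^ (n - i)))"

text \<open>Only a bound \<open>n\<close> on the degree is required, so that several polynomials can
  be homogenized in one common degree: \<open>u\<close> and \<open>v\<close> of a fraction, or the
  three components of \<open>q\<close>.\<close>

lemma poly_homog_subst:
  assumes "degree r \<le> n" "poly d t \<noteq> 0"
  shows "poly (homog_subst n r a d) t = poly d t ^ n * poly r (poly a t / poly d t)"
proof -
  have "poly r x = (\<Sum>i\<le>n. coeff r i * x ^ i)" for x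
    unfolding poly_altdef using assms(1)
    by (intro sum.mono_neutral_left) (auto intro: coeff_eq_0)
  then show ?thesis using assms(2)
    by (auto simp: homog_subst_def poly_sum sum_distrib_left power_divide power_diff intro!: sum.cong)
qed

lemma degree_homog_subst:
  assumes "degree a \<le> 1" "degree d \<le> 1"
  shows "degree (homog_subst n r a d) \<le> n"
  unfolding homog_subst_def
proof (intro degree_sum_le order.trans[OF degree_smult_le])
  fix i assume "i \<in> {..n}"
  have "degree (a ^ i * d ^ (n - i)) \<le> degree a * i + degree d * (n - i)"
    using degree_mult_le[of "a ^ i" "d ^ (n - i)"] degree_power_le[of a i] degree_power_le[of d "n - i"]
    by linarith
  also have "\<dots> \<le> 1 * i + 1 * (n - i)" using assms by (intro add_mono mult_right_mono) auto
  finally show "degree (a ^ i * d ^ (n - i)) \<le> n" using \<open>i \<in> {..n}\<close> by simp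
qed simp

text \<open>Modulo \<open>d\<close> only the term with \<open>i = n\<close> survives, modulo
  \<open>a\<close> only the one with \<open>i = 0\<close>.\<close>

lemma homog_subst_cong:
  shows "d dvd homog_subst n r a d - smult (coeff r n) (a ^ n)"
    and "a dvd homog_subst n r a d - smult (coeff r 0) (d ^ n)"
proof -
  have "homog_subst n r a d =
      smult (coeff r n) (a ^ n) + (\<Sum>i<n. smult (coeff r i) (a ^ i * d ^ (n - i)))"
    by (simp add: homog_subst_def lessThan_Suc_atMost[symmetric])
  then show "d dvd homog_subst n r a d - smult (coeff r n) (a ^ n)"
    by (auto intro!: dvd_sum dvd_smult dvd_mult dvd_power)
  have "homog_subst n r a d =
      smult (coeff r 0) (d ^ n) + (\<Sum>i<n. smult (coeff r (Suc i)) (a ^ Suc i * d ^ (n - Suc i)))"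
    unfolding homog_subst_def by (subst sum.atMost_shift) simp
  then show "a dvd homog_subst n r a d - smult (coeff r 0) (d ^ n)"
    by (auto intro!: dvd_sum dvd_smult)
qed

text \<open>Clearing denominators in \<open>\<psi> (\<psi> t) = t\<close> for \<open>\<psi> = u / v\<close> of degree \<open>d\<close> gives
  \<open>\<Sum>\<^sub>i (u\<^sub>i - t v\<^sub>i) u\<^sup>i v\<^sup>d\<^sup>-\<^sup>i = 0\<close>. By coprimality, \<open>v\<close> divides the linear coefficient of
  \<open>u\<^sup>d\<close> and \<open>u\<close> divides the one of \<open>v\<^sup>d\<close>.\<close>

lemma rational_involution_degree:
  fixes u v :: "real poly"
  assumes "coprime u v" "v \<noteq> 0"
    and inv: "MOST t. poly v t \<noteq> 0 \<and> poly v (poly u t / poly v t) \<noteq> 0 \<and>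
      poly u (poly u t / poly v t) / poly v (poly u t / poly v t) = t"
  shows "degree u \<le> 1" "degree v \<le> 1"
proof -
  define d where "d = max (degree u) (degree v)"
  have "homog_subst d u u v = [:0, 1:] * homog_subst d v u v"
    by (rule poly_eq_if_MOST, rule eventually_mono[OF inv])
      (auto simp: poly_homog_subst d_def field_simps)
  note eq = this
  have "v dvd homog_subst d u u v - smult (coeff u d) (u ^ d)
      - [:0, 1:] * (homog_subst d v u v - smult (coeff v d) (u ^ d))"
    by (intro dvd_diff dvd_mult homog_subst_cong)
  also have "\<dots> = [:- coeff u d, coeff v d:] * u ^ d"
    unfolding eq by (simp add: algebra_simps)
  finally have v: "v dvd [:- coeff u d, coeff v d:]"
    using assms(1) by (subst (asm) coprime_dvd_mult_left_iff) (simp_all add: coprime_commute)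
  have "u dvd homog_subst d u u v - smult (coeff u 0) (v ^ d)
      - [:0, 1:] * (homog_subst d v u v - smult (coeff v 0) (v ^ d))"
    by (intro dvd_diff dvd_mult homog_subst_cong)
  also have "\<dots> = [:- coeff u 0, coeff v 0:] * v ^ d"
    unfolding eq by (simp add: algebra_simps)
  finally have u: "u dvd [:- coeff u 0, coeff v 0:]"
    using assms(1) by (subst (asm) coprime_dvd_mult_left_iff) simp_all
  \<comment> \<open>As \<open>d\<close> is the larger degree, one of the two top coefficients is
    nonzero. The linear polynomial divisible by \<open>v\<close> is then nonzero and bounds the
    degree of \<open>v\<close>.\<close>
  have "coeff u d \<noteq> 0 \<or> coeff v d \<noteq> 0"
  proof (cases "degree u \<le> degree v")
    case True then show ?thesis using assms(2) by (simp add: d_def max_def)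
  next
    case False then show ?thesis by (auto simp: d_def max_def)
  qed
  then have "degree v \<le> degree [:- coeff u d, coeff v d:]" by (intro dvd_imp_degree_le v) auto
  then show "degree v \<le> 1" by (auto split: if_splits)
  have "coeff u 0 \<noteq> 0 \<or> coeff v 0 \<noteq> 0"
  proof (rule ccontr)
    assume "\<not> ?thesis"
    then have "[:0, 1:] dvd u" "[:0, 1:] dvd v"
      using poly_eq_0_iff_dvd[of u 0] poly_eq_0_iff_dvd[of v 0] by (auto simp: poly_0_coeff_0)
    then have "is_unit [:0, 1 :: real:]" using assms(1) coprime_common_divisor by blast
    then show False by (simp add: is_unit_pCons_iff)
  qed
  then have "degree u \<le> degree [:- coeff u 0, coeff v 0:]" by (intro dvd_imp_degree_le u) auto
  then show "degree u \<le> 1" by (auto split: if_splits)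
qed

text \<open>Cross-multiplying and comparing coefficients says that the square of the coefficient
  matrix is scalar. Hence its trace vanishes, or the matrix itself is scalar.\<close>

lemma moebius_involution:
  fixes \<alpha> \<beta> \<gamma> \<delta> :: real
  assumes "MOST t. \<gamma> * t + \<delta> \<noteq> 0 \<and> \<gamma> * ((\<alpha> * t + \<beta>) / (\<gamma> * t + \<delta>)) + \<delta> \<noteq> 0 \<and>
    (\<alpha> * ((\<alpha> * t + \<beta>) / (\<gamma> * t + \<delta>)) + \<beta>) / (\<gamma> * ((\<alpha> * t + \<beta>) / (\<gamma> * t + \<delta>)) + \<delta>) = t"
  shows "\<alpha> * \<delta> - \<beta> * \<gamma> \<noteq> 0 \<and> (\<alpha> = - \<delta> \<or> \<beta> = 0 \<and> \<gamma> = 0 \<and> \<alpha> = \<delta> \<and> \<delta> \<noteq> 0)"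
proof -
  have den: "MOST t. \<gamma> * (\<alpha> * t + \<beta>) + \<delta> * (\<gamma> * t + \<delta>) \<noteq> 0"
    using assms by eventually_elim (auto simp: field_simps)
  have "[:\<alpha> * \<beta> + \<beta> * \<delta>, \<alpha>\<^sup>2 + \<beta> * \<gamma>:] = [:0, \<beta> * \<gamma> + \<delta>\<^sup>2, \<gamma> * (\<alpha> + \<delta>):]"
  proof (rule poly_eq_if_MOST, rule eventually_rev_mp[OF assms], rule eventually_mono[OF den], intro impI)
    fix t
    let ?w = "\<gamma> * t + \<delta>" and ?y = "\<alpha> * t + \<beta>"
    assume *: "\<gamma> * ?y + \<delta> * ?w \<noteq> 0"
      "?w \<noteq> 0 \<and> \<gamma> * (?y / ?w) + \<delta> \<noteq> 0 \<and> (\<alpha> * (?y / ?w) + \<beta>) / (\<gamma> * (?y / ?w) + \<delta>) = t"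
    have eqs: "\<alpha> * (?y / ?w) + \<beta> = (\<alpha> * ?y + \<beta> * ?w) / ?w" "\<gamma> * (?y / ?w) + \<delta> = (\<gamma> * ?y + \<delta> * ?w) / ?w"
      using * by (simp_all add: add_divide_eq_iff distrib_left divide_simps mult.commute)
    have "(\<alpha> * ?y + \<beta> * ?w) / (\<gamma> * ?y + \<delta> * ?w) = t"
      using *(2) unfolding eqs by (auto split: if_splits)
    then have "\<alpha> * ?y + \<beta> * ?w = t * (\<gamma> * ?y + \<delta> * ?w)" using *(1) by (simp add: nonzero_divide_eq_eq)
    then show "poly [:\<alpha> * \<beta> + \<beta> * \<delta>, \<alpha>\<^sup>2 + \<beta> * \<gamma>:] t = poly [:0, \<beta> * \<gamma> + \<delta>\<^sup>2, \<gamma> * (\<alpha> + \<delta>):] t"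
      by (simp add: algebra_simps power2_eq_square)
  qed
  then have eqs: "\<beta> * (\<alpha> + \<delta>) = 0" "\<gamma> * (\<alpha> + \<delta>) = 0" "\<alpha>\<^sup>2 = \<delta>\<^sup>2"
    by (auto simp: algebra_simps split: if_splits)
  obtain t where t: "\<gamma> * (\<alpha> * t + \<beta>) + \<delta> * (\<gamma> * t + \<delta>) \<noteq> 0" using den by (blast dest: MOST_real_ex)
  show ?thesis
  proof (cases "\<alpha> = - \<delta>")
    case True
    \<comment> \<open>For trace zero the denominator of the composition is the constant
      \<open>\<gamma> * \<beta> + \<delta>\<^sup>2\<close>, the negative of the determinant.\<close>
    then show ?thesis using t by (auto simp: algebra_simps)
  next
    case False
    then have "\<alpha> + \<delta> \<noteq> 0" by linarith
    then have "\<beta> = 0" "\<gamma> = 0" using eqs by auto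
    moreover have "\<alpha> = \<delta>" using eqs(3) False by (simp add: power2_eq_iff)
    ultimately show ?thesis using t by auto
  qed
qed

text \<open>The vector \<open>w\<close>, obtained by applying \<open>Q\<close> to the homogenized
  \<open>q \<circ> \<psi>\<close>, is proportional to \<open>q\<close>. Coprimality makes the factor
  a polynomial, and comparing degrees makes it constant.\<close>

lemma homogeneous_direction:
  fixes q :: "real poly ^ 3" and Q :: "real ^ 3 ^ 3"
  defines "dir t \<equiv> (\<chi> i. poly (q $ i) t)"
  assumes coprime: "gcd (q $ 1) (gcd (q $ 2) (q $ 3)) = 1"
    and n: "n = max (degree (q $ 1)) (max (degree (q $ 2)) (degree (q $ 3)))"
    and QQ: "\<And>x. Q *v (Q *v x) = x"
    and parallel: "MOST t. \<gamma> * t + \<delta> \<noteq> 0 \<and>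
      (\<exists>a. Q *v dir t = a *\<^sub>R dir ((\<alpha> * t + \<beta>) / (\<gamma> * t + \<delta>)))"
  shows "\<exists>k. MOST t. Q *v dir t = (k * (\<gamma> * t + \<delta>) ^ n) *\<^sub>R dir ((\<alpha> * t + \<beta>) / (\<gamma> * t + \<delta>))"
    and "dir t \<noteq> 0"
proof -
  \<comment> \<open>Bezout coefficients with \<open>e1 * q $ 1 + e2 * q $ 2 + e3 * q $ 3 = 1\<close>
    show that \<open>q\<close> has no real zero. Later they express any polynomial vector
    proportional to \<open>q\<close> as a polynomial multiple of it.\<close>
  obtain x y where xy: "x * q $ 2 + y * q $ 3 = gcd (q $ 2) (q $ 3)"
    using bezout_coefficients_fst_snd by blast
  obtain x' y' where "x' * q $ 1 + y' * gcd (q $ 2) (q $ 3) = 1"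
    using bezout_coefficients_fst_snd[of "q $ 1" "gcd (q $ 2) (q $ 3)"] coprime by metis
  then have "x' * q $ 1 + (y' * x) * q $ 2 + (y' * y) * q $ 3 = 1"
    by (simp add: distrib_left mult.assoc add.assoc flip: xy)
  then obtain e1 e2 e3 where e: "e1 * q $ 1 + e2 * q $ 2 + e3 * q $ 3 = 1" by blast
  show dir_neq: "dir t \<noteq> 0" for t
  proof
    assume "dir t = 0"
    then have "poly (q $ i) t = 0" for i by (simp add: dir_def vec_eq_iff)
    then have "poly (e1 * q $ 1 + e2 * q $ 2 + e3 * q $ 3) t = 0" by simp
    then show False by (simp add: e)
  qed
  have deg: "degree (q $ i) \<le> n" for i using n exhaust_3[of i] by auto
  \<comment> \<open>The zero polynomial also has degree 0, so for \<open>n = 0\<close> a nonzero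
    component has to be found separately.\<close>
  have "\<exists>j. q $ j \<noteq> 0 \<and> degree (q $ j) = n"
  proof (cases "n = 0")
    case True
    obtain j where "q $ j \<noteq> 0"
    proof (rule ccontr)
      assume "\<not> thesis"
      then have "q $ j = 0" for j using that by blast
      then have "dir 0 = 0" by (simp add: dir_def vec_eq_iff)
      then show False using dir_neq by blast
    qed
    then show ?thesis using deg[of j] True by auto
  next
    case False
    obtain j where "degree (q $ j) = n" using n by (metis max_def)
    then show ?thesis using False by (intro exI[of _ j]) auto
  qed
  then obtain j where j: "q $ j \<noteq> 0" "degree (q $ j) = n" by blast
  define r where "r = (\<chi> i. homog_subst n (q $ i) [:\<beta>, \<alpha>:] [:\<delta>, \<gamma>:])"
  define w where "w = linear_poly Q r"
  let ?\<psi> = "\<lambda>t. (\<alpha> * t + \<beta>) / (\<gamma> * t + \<delta>)"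
  have w: "(\<chi> i. poly (w $ i) t) = (\<gamma> * t + \<delta>) ^ n *\<^sub>R (Q *v dir (?\<psi> t))" if "\<gamma> * t + \<delta> \<noteq> 0" for t
  proof -
    have "poly (r $ i) t = (\<gamma> * t + \<delta>) ^ n * poly (q $ i) (?\<psi> t)" for i
      using poly_homog_subst[OF deg[of i], of "[:\<delta>, \<gamma>:]" t "[:\<beta>, \<alpha>:]"] that
      by (simp add: r_def add.commute mult.commute[of t])
    then have "(\<chi> i. poly (r $ i) t) = (\<gamma> * t + \<delta>) ^ n *\<^sub>R dir (?\<psi> t)"
      by (simp add: vec_eq_iff dir_def)
    then show ?thesis by (simp add: w_def linear_poly_eval matrix_vector_mult_scaleR)
  qed
  have par: "MOST t. \<gamma> * t + \<delta> \<noteq> 0 \<and> (\<exists>a. dir t = a *\<^sub>R (\<chi> i. poly (w $ i) t))"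
    using parallel
  proof eventually_elim
    case (elim t)
    then obtain a where a: "\<gamma> * t + \<delta> \<noteq> 0" "Q *v dir t = a *\<^sub>R dir (?\<psi> t)" by blast
    \<comment> \<open>A second application of \<open>Q\<close> makes the never vanishing vector
      \<open>dir t\<close> the multiple, which later excludes \<open>K = 0\<close>.\<close>
    have "dir t = a *\<^sub>R (Q *v dir (?\<psi> t))"
      using arg_cong[OF a(2), of "\<lambda>x. Q *v x"] by (simp add: QQ matrix_vector_mult_scaleR)
    then have "dir t = (a / (\<gamma> * t + \<delta>) ^ n) *\<^sub>R (\<chi> i. poly (w $ i) t)"
      using w[OF a(1)] a(1) by simp
    with a(1) show ?case by blast
  qed
  have cross: "q $ i * w $ l = q $ l * w $ i" for i l
  proof (rule poly_eq_if_MOST, rule eventually_mono[OF par])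
    fix t assume "\<gamma> * t + \<delta> \<noteq> 0 \<and> (\<exists>a. dir t = a *\<^sub>R (\<chi> i. poly (w $ i) t))"
    then obtain a where "\<And>i. poly (q $ i) t = a * poly (w $ i) t"
      by (auto simp: dir_def vec_eq_iff)
    then show "poly (q $ i * w $ l) t = poly (q $ l * w $ i) t" by simp
  qed
  define K where "K = e1 * w $ 1 + e2 * w $ 2 + e3 * w $ 3"
  have wK: "w $ l = K * q $ l" for l
  proof -
    have "w $ l = (e1 * q $ 1 + e2 * q $ 2 + e3 * q $ 3) * w $ l" by (simp add: e)
    also have "\<dots> = e1 * (q $ 1 * w $ l) + e2 * (q $ 2 * w $ l) + e3 * (q $ 3 * w $ l)"
      by (simp add: algebra_simps)
    also have "\<dots> = K * q $ l"
      unfolding cross[of 1 l] cross[of 2 l] cross[of 3 l] K_def by (simp add: algebra_simps)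
    finally show ?thesis .
  qed
  have "K \<noteq> 0"
  proof
    assume "K = 0"
    then have "(\<chi> i. poly (w $ i) t) = 0" for t by (simp add: wK vec_eq_iff)
    then show False using MOST_real_ex[OF par] dir_neq by auto
  qed
  \<comment> \<open>Substituting a fraction of linear polynomials homogeneously keeps the degree at
    most \<open>n\<close>, and \<open>q $ j\<close> already has degree \<open>n\<close>. Nothing is
    left for \<open>K\<close>.\<close>
  have "degree (w $ j) \<le> n"
    unfolding w_def linear_poly_def r_def
    by (auto intro!: degree_sum_le order.trans[OF degree_smult_le] degree_homog_subst)
  then have "degree K = 0" using j \<open>K \<noteq> 0\<close> by (simp add: wK degree_mult_eq)
  then obtain \<kappa> where \<kappa>: "K = [:\<kappa>:]" using degree_eq_zeroE by blast
  have "\<kappa> \<noteq> 0" using \<kappa> \<open>K \<noteq> 0\<close> by simp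
  have "MOST t. Q *v dir t = (inverse \<kappa> * (\<gamma> * t + \<delta>) ^ n) *\<^sub>R dir (?\<psi> t)"
    using par
  proof eventually_elim
    case (elim t)
    have "\<kappa> *\<^sub>R dir t = (\<gamma> * t + \<delta>) ^ n *\<^sub>R (Q *v dir (?\<psi> t))"
      using w[of t] elim by (simp add: wK \<kappa> dir_def vec_eq_iff)
    then have "\<kappa> *\<^sub>R (Q *v dir t) = (\<gamma> * t + \<delta>) ^ n *\<^sub>R dir (?\<psi> t)"
      by (metis QQ matrix_vector_mult_scaleR)
    then have "inverse \<kappa> *\<^sub>R \<kappa> *\<^sub>R (Q *v dir t) = inverse \<kappa> *\<^sub>R (\<gamma> * t + \<delta>) ^ n *\<^sub>R dir (?\<psi> t)"
      by (rule arg_cong)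
    then show ?case using \<open>\<kappa> \<noteq> 0\<close> by simp
  qed
  then show "\<exists>k. MOST t. Q *v dir t = (k * (\<gamma> * t + \<delta>) ^ n) *\<^sub>R dir (?\<psi> t)" by blast
qed

section \<open>The involution in the parameter plane\<close>

locale ruled_involution =
  fixes S :: "(real ^ 3) set" and p :: "real poly fract ^ 3" and q :: "real poly ^ 3"
    and Q :: "real ^ 3 ^ 3" and b :: "real ^ 3" and f :: "real ^ 3 \<Rightarrow> real ^ 3"
    and \<phi> :: "real \<times> real \<Rightarrow> real \<times> real"
  assumes proper: "proper_ruled_parametrization S p q"
    and not_doubly_ruled: "\<not> doubly_ruled S"
    and f_eq: "f = isometry_map Q b"
    and f_image: "f ` S = S"
    and f_f: "f \<circ> f = id"
    and birational: "birational_on UNIV UNIV \<phi>"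
    and commute: "generically UNIV (\<lambda>z. f (ruled_map p q z) = ruled_map p q (\<phi> z))"
begin

abbreviation "x \<equiv> ruled_map p q"

lemma f_f_eq [simp]: "f (f y) = y"
  using fun_cong[OF f_f, of y] by simp

lemma Q_Q: "Q *v (Q *v y) = y"
  using f_f_eq[of y] f_f_eq[of 0]
  by (simp add: f_eq isometry_map_def matrix_vector_right_distrib add.assoc)

lemma parametrization_inverse: "\<exists>\<eta>. generically UNIV (\<lambda>v. \<eta> (x v) = v)"
proof -
  have "birational_on UNIV S x" using proper unfolding proper_ruled_parametrization_def by blast
  then show ?thesis unfolding birational_on_def by (blast intro: generically_mono)
qed

text \<open>Both \<open>v\<close> and \<open>\<phi> (\<phi> v)\<close> are parameters of the point
  \<open>f (f (x v)) = x v\<close>, and \<open>\<eta>\<close> recovers each of them from that point.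
  Dominance of \<open>\<phi>\<close> carries the generic conditions along.\<close>

lemma \<phi>_involution: "generically UNIV (\<lambda>v. \<phi> (\<phi> v) = v)"
proof -
  obtain \<eta> where \<eta>: "generically UNIV (\<lambda>v. \<eta> (x v) = v)" using parametrization_inverse by blast
  note subst = generically_compose_birational[OF birational]
  show ?thesis
    using generically_plane_conj[OF generically_plane_conj[OF commute subst[OF commute]]
        generically_plane_conj[OF \<eta> subst[OF subst[OF \<eta>]]]]
    by (rule generically_mono) (metis f_f_eq)
qed

text \<open>For infinitely many \<open>t\<close> the image of the ruling at \<open>t\<close> is the ruling at some \<open>t'\<close>, since
  otherwise \<open>x\<close> and \<open>f \<circ> x\<close> would parametrize two different families of rulings. For such \<open>t\<close>
  the first component of \<open>\<phi> (t, s)\<close> is \<open>t'\<close>, independently of \<open>s\<close>.\<close>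

lemma fst_\<phi>_rational:
  "\<exists>A B. B \<noteq> 0 \<and> generically UNIV (\<lambda>v. poly B (fst v) \<noteq> 0 \<and> fst (\<phi> v) = poly A (fst v) / poly B (fst v))"
proof -
  define p' q' where "p' = affine_rf Q b p" and "q' = linear_poly Q q"
  obtain \<eta> where \<eta>: "generically UNIV (\<lambda>v. \<eta> (x v) = v)" using parametrization_inverse by blast
  obtain N D where "rational_rep UNIV \<phi> N D" using birational by (auto simp: birational_on_def)
  then have N: "polynomial_function N" and D: "real_polynomial_function D" and "\<exists>v. D v \<noteq> 0"
    and \<phi>: "\<And>v. D v \<noteq> 0 \<Longrightarrow> \<phi> v = N v /\<^sub>R D v"
    by (auto simp: rational_rep_def)
  then obtain t0 s0 where D0: "D (t0, s0) \<noteq> 0" by auto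
  have fst_N: "real_polynomial_function (\<lambda>v. fst (N v))"
    using bounded_linear_compose_polynomial_function[OF bounded_linear_fst N] .
  have "proper_ruled_parametrization S p' q'"
    unfolding p'_def q'_def
    using proper_ruled_parametrization_affine[OF proper f_eq f_f f_image] .
  then have "infinite (rulings p q \<inter> rulings p' q')"
    using not_doubly_ruled proper unfolding doubly_ruled_def by blast
  define I where "I = rulings p q \<inter> rulings p' q'"
  have "infinite I" unfolding I_def by fact
  have "\<exists>t t'. L = range (\<lambda>s. f (x (t, s))) \<and> L = range (\<lambda>s. x (t', s)) \<and>
      (\<exists>i. poly (q $ i) t \<noteq> 0)" if L: "L \<in> I" for L
  proof -
    obtain t where t: "L = range (\<lambda>s. ruled_map p' q' (t, s))"
      "\<And>i. rf_defined (p' $ i) t" "\<exists>i. poly (q' $ i) t \<noteq> 0"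
      using L by (auto simp: I_def rulings_def)
    have "affine_rf Q b p' = p" unfolding p'_def using affine_rf_involution f_f f_eq by blast
    then have "rf_defined (p $ i) t" for i using affine_rf_eval(1)[of p' t Q b i] t(2) by simp
    then have "L = range (\<lambda>s. f (x (t, s)))"
      unfolding t(1) p'_def q'_def f_eq by (simp add: ruled_map_affine)
    moreover have "\<exists>i. poly (q $ i) t \<noteq> 0"
      using t(3) by (auto simp: q'_def linear_poly_def poly_sum intro!: sum.neutral)
    moreover have "\<exists>t'. L = range (\<lambda>s. x (t', s))" using L by (auto simp: I_def rulings_def)
    ultimately show ?thesis by blast
  qed
  then obtain \<tau> \<tau>' where \<tau>: "\<And>L. L \<in> I \<Longrightarrow> range (\<lambda>s. f (x (\<tau> L, s))) = L"
    "\<And>L. L \<in> I \<Longrightarrow> range (\<lambda>s. x (\<tau>' L, s)) = L" "\<And>L. L \<in> I \<Longrightarrow> \<exists>i. poly (q $ i) (\<tau> L) \<noteq> 0"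
    by metis
  \<comment> \<open>A line is determined by its parameter under either choice, so infinitely many
    common rulings give infinitely many parameters, and discarding finitely many bad parameters
    keeps infinitely many lines.\<close>
  have inj: "inj_on \<tau> I" "inj_on \<tau>' I" using \<tau>(1,2) by (metis inj_onI)+
  define G where "G t \<longleftrightarrow> (MOST s. f (x (t, s)) = x (\<phi> (t, s)) \<and> \<eta> (x (\<phi> (t, s))) = \<phi> (t, s) \<and>
    D (t, s) \<noteq> 0)" for t
  define G' where "G' t \<longleftrightarrow> (MOST s. \<eta> (x (t, s)) = (t, s))" for t
  have "MOST t. G t"
    unfolding G_def
    using generically_planeD(1)[OF generically_plane_conj[OF commute
          generically_plane_conj[OF generically_compose_birational[OF birational \<eta>]
            generically_poly_function_neq_0[OF D D0]]]] .
  moreover have "MOST t. G' t" unfolding G'_def using generically_planeD(1)[OF \<eta>] .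
  ultimately have fin: "finite (\<tau> -` {t. \<not> G t} \<inter> I)" "finite (\<tau>' -` {t. \<not> G' t} \<inter> I)"
    using finite_vimage_IntI[OF _ inj(1), of "{t. \<not> G t}"]
      finite_vimage_IntI[OF _ inj(2), of "{t. \<not> G' t}"] by (simp_all add: MOST_iff_cofinite)
  define J where "J = {L \<in> I. G (\<tau> L) \<and> G' (\<tau>' L)}"
  have "I \<subseteq> J \<union> (\<tau> -` {t. \<not> G t} \<inter> I) \<union> (\<tau>' -` {t. \<not> G' t} \<inter> I)" by (auto simp: J_def)
  then have "infinite J" using fin \<open>infinite I\<close> by (metis finite_UnI finite_subset)
  then have inf: "infinite (\<tau> ` J)"
    using inj_on_subset[OF inj(1), of J] by (auto simp: J_def finite_image_iff)
  \<comment> \<open>Vanishing of \<open>g\<close> says that the first component of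
    \<open>\<phi>\<close> at \<open>v\<close> equals the one on the line \<open>s = s0\<close>,
    denominators cleared. Being polynomial, \<open>g\<close> only has to vanish for infinitely many
    \<open>t\<close>.\<close>
  define g where "g v = fst (N v) * D (fst v, s0) - fst (N (fst v, s0)) * D v" for v
  have line: "polynomial_function (\<lambda>v :: real \<times> real. (fst v, s0))"
  proof -
    have "polynomial_function (\<lambda>v :: real \<times> real. (fst v, 0) + (0, s0 :: real))"
      by (intro polynomial_function_add polynomial_function_const polynomial_function_bounded_linear
          bounded_linear_Pair bounded_linear_fst bounded_linear_zero)
    then show ?thesis by simp
  qed
  have g: "real_polynomial_function g"
    unfolding g_def
    using real_polynomial_function_compose[OF line D] real_polynomial_function_compose[OF line fst_N]
    by (intro real_polynomial_function_diff real_polynomial_function.intros(4) fst_N D)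
      (simp_all add: o_def)
  have "g (t, s) = 0" if "t \<in> \<tau> ` J" for t s
  proof -
    obtain L where L: "L \<in> I" "G t" "G' (\<tau>' L)" "t = \<tau> L" using \<open>t \<in> \<tau> ` J\<close> by (auto simp: J_def)
    define t' where "t' = \<tau>' L"
    have "range (\<lambda>s. f (x (t, s))) = range (\<lambda>s. x (t', s))"
      using \<tau>(1,2)[OF L(1)] by (simp add: L(4) t'_def)
    then have "\<exists>\<sigma>. f (x (t, s)) = x (t', \<sigma>)" for s by blast
    then obtain \<sigma> where \<sigma>: "\<And>s. f (x (t, s)) = x (t', \<sigma> s)" by metis
    \<comment> \<open>Injectivity ensures that only finitely many \<open>s\<close> are sent to the
      exceptional points of the target ruling.\<close>
    have "inj \<sigma>"
    proof
      fix s1 s2 assume "\<sigma> s1 = \<sigma> s2"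
      then have "x (t, s1) = x (t, s2)" using \<sigma> by (metis f_f_eq)
      then show "s1 = s2" using \<tau>(3)[OF L(1)] by (auto simp: ruled_map_def vec_eq_iff L(4))
    qed
    then have "MOST s. \<eta> (x (t', \<sigma> s)) = (t', \<sigma> s)"
      using L(3) unfolding G'_def t'_def[symmetric] by (rule MOST_inj[rotated])
    moreover have "MOST s. f (x (t, s)) = x (\<phi> (t, s)) \<and> \<eta> (x (\<phi> (t, s))) = \<phi> (t, s) \<and> D (t, s) \<noteq> 0"
      using L(2) by (simp add: G_def)
    ultimately have "MOST s. fst (N (t, s)) - t' * D (t, s) = 0"
    proof eventually_elim
      case (elim s)
      then have "\<phi> (t, s) = (t', \<sigma> s)" using \<sigma>[of s] by metis
      then show ?case using \<phi>[of "(t, s)"] elim by (auto simp: field_simps prod_eq_iff)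
    qed
    \<comment> \<open>The relation is polynomial in \<open>s\<close>, hence valid for all
      \<open>s\<close>, in particular for \<open>s0\<close>; the two instances together eliminate
      \<open>t'\<close>.\<close>
    then have "INFM s. fst (N (t, s)) - t' * D (t, s) = 0"
      by (rule MOST_INFM[OF infinite_UNIV_char_0])
    then have "fst (N (t, s)) - t' * D (t, s) = 0" for s
      by (rule poly_function_line_eq_0[where g = "\<lambda>v. fst (N v) - t' * D v", rotated])
        (intro real_polynomial_function_diff real_polynomial_function.intros(2,4) fst_N D)
    then show ?thesis by (simp add: g_def algebra_simps)
  qed
  then have "\<tau> ` J \<subseteq> {t. INFM s. g (t, s) = 0}" by (auto simp: infinite_UNIV_char_0)
  then have "INFM t. INFM s. g (t, s) = 0"
    using inf by (subst frequently_cofinite) (rule infinite_super)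
  then have g0: "g v = 0" for v by (rule poly_function_plane_eq_0[OF g])
  obtain A where A: "\<And>t. fst (N (t, s0)) = poly A t"
    using real_polynomial_function_plane[OF fst_N] by blast
  obtain B where B: "\<And>t. D (t, s0) = poly B t"
    using real_polynomial_function_plane[OF D] by blast
  have B0: "poly B t0 \<noteq> 0" using B D0 by metis
  have "generically UNIV (\<lambda>v::real \<times> real. poly B (fst v) \<noteq> 0)"
    by (rule generically_poly_function_neq_0[where v = "(t0, s0)"])
      (auto intro: real_polynomial_function_poly_compose real_polynomial_function_fst simp: B0)
  from generically_plane_conj[OF this generically_poly_function_neq_0[OF D D0]]
  have "generically UNIV (\<lambda>v. poly B (fst v) \<noteq> 0 \<and> fst (\<phi> v) = poly A (fst v) / poly B (fst v))"
  proof (rule generically_mono)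
    fix v assume v: "poly B (fst v) \<noteq> 0 \<and> D v \<noteq> 0"
    have "fst (N v) * poly B (fst v) = poly A (fst v) * D v"
      using g0[of v] by (simp add: g_def A B)
    moreover have "fst (\<phi> v) = fst (N v) / D v"
      using v \<phi>[of v] by (simp add: divide_inverse mult.commute)
    ultimately show "poly B (fst v) \<noteq> 0 \<and> fst (\<phi> v) = poly A (fst v) / poly B (fst v)"
      using v by (simp add: frac_eq_eq)
  qed
  moreover have "B \<noteq> 0" using B0 by auto
  ultimately show ?thesis by blast
qed

text \<open>In lowest terms, the first component of \<open>\<phi> (\<phi> z) = z\<close> becomes an
  identity in \<open>t\<close> alone, to which the degree bound and the classification of Moebius
  involutions apply.\<close>

lemma fst_\<phi>_moebius:
  "\<exists>\<alpha> \<beta> \<gamma> \<delta>. \<alpha> * \<delta> - \<beta> * \<gamma> \<noteq> 0 \<and> (\<alpha> = - \<delta> \<or> \<beta> = 0 \<and> \<gamma> = 0 \<and> \<alpha> = \<delta> \<and> \<delta> \<noteq> 0) \<and>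
     generically UNIV (\<lambda>v. \<gamma> * fst v + \<delta> \<noteq> 0 \<and> fst (\<phi> v) = (\<alpha> * fst v + \<beta>) / (\<gamma> * fst v + \<delta>))"
proof -
  obtain A B where "B \<noteq> 0" and
    AB: "generically UNIV (\<lambda>v. poly B (fst v) \<noteq> 0 \<and> fst (\<phi> v) = poly A (fst v) / poly B (fst v))"
    using fst_\<phi>_rational by blast
  obtain u v where uv: "A = u * gcd A B" "B = v * gcd A B" "coprime u v"
    using gcd_coprime_exists[of A B] \<open>B \<noteq> 0\<close> by auto
  have ev: "poly A t = poly u t * poly (gcd A B) t" "poly B t = poly v t * poly (gcd A B) t" for t
    using uv(1,2) by (metis poly_mult)+
  have red: "generically UNIV (\<lambda>z. poly v (fst z) \<noteq> 0 \<and> fst (\<phi> z) = poly u (fst z) / poly v (fst z))"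
    by (rule generically_mono[OF AB]) (auto simp: ev)
  have "generically UNIV (\<lambda>z. (poly v (fst z) \<noteq> 0 \<and> fst (\<phi> z) = poly u (fst z) / poly v (fst z)) \<and>
    (poly v (fst (\<phi> z)) \<noteq> 0 \<and> fst (\<phi> (\<phi> z)) = poly u (fst (\<phi> z)) / poly v (fst (\<phi> z))) \<and>
    \<phi> (\<phi> z) = z)"
    by (intro generically_plane_conj red \<phi>_involution generically_compose_birational[OF birational red])
  then have "generically UNIV (\<lambda>z :: real \<times> real. poly v (fst z) \<noteq> 0 \<and> poly v (poly u (fst z) / poly v (fst z)) \<noteq> 0 \<and>
      poly u (poly u (fst z) / poly v (fst z)) / poly v (poly u (fst z) / poly v (fst z)) = fst z)"
    by (rule generically_mono) metis
  from generically_planeD(1)[OF this]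
  have "MOST t. MOST s :: real. poly v t \<noteq> 0 \<and> poly v (poly u t / poly v t) \<noteq> 0 \<and>
      poly u (poly u t / poly v t) / poly v (poly u t / poly v t) = t" by simp
  then have inv: "MOST t. poly v t \<noteq> 0 \<and> poly v (poly u t / poly v t) \<noteq> 0 \<and>
      poly u (poly u t / poly v t) / poly v (poly u t / poly v t) = t"
    by (rule eventually_mono) (use MOST_real_ex in blast)
  have "v \<noteq> 0" using uv \<open>B \<noteq> 0\<close> by auto
  note deg = rational_involution_degree[OF uv(3) this inv]
  have lin: "poly r t = coeff r 1 * t + coeff r 0" if "degree r \<le> 1" for r and t :: real
  proof -
    have "r = [:coeff r 0, coeff r 1:]"
      using that by (intro poly_eqI) (auto simp: coeff_pCons split: nat.split intro: coeff_eq_0)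
    from arg_cong[OF this, of "\<lambda>r. poly r t"] show ?thesis by (simp add: mult.commute)
  qed
  note red[unfolded lin[OF deg(1)] lin[OF deg(2)]]
  moreover note moebius_involution[OF inv[unfolded lin[OF deg(1)] lin[OF deg(2)]]]
  ultimately show ?thesis by blast
qed

text \<open>Differences of two points on a ruling eliminate \<open>p\<close> and \<open>b\<close>.
  Since \<open>q\<close> never vanishes, they determine the second component of
  \<open>\<phi>\<close> up to its value on one line \<open>s = s0\<close>, which is rational in
  \<open>t\<close>.\<close>

lemma \<phi>_form:
  assumes "gcd (q $ 1) (gcd (q $ 2) (q $ 3)) = 1"
    and "n = max (degree (q $ 1)) (max (degree (q $ 2)) (degree (q $ 3)))"
    and moebius: "generically UNIV (\<lambda>v. \<gamma> * fst v + \<delta> \<noteq> 0 \<and>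
      fst (\<phi> v) = (\<alpha> * fst v + \<beta>) / (\<gamma> * fst v + \<delta>))"
  shows "\<exists>k c. generically UNIV (\<lambda>v. \<gamma> * fst v + \<delta> \<noteq> 0 \<and>
    \<phi> v = ((\<alpha> * fst v + \<beta>) / (\<gamma> * fst v + \<delta>), k * (\<gamma> * fst v + \<delta>) ^ n * snd v + rf_eval c (fst v)))"
proof -
  define dir where "dir t = (\<chi> i. poly (q $ i) t)" for t
  let ?\<psi> = "\<lambda>t. (\<alpha> * t + \<beta>) / (\<gamma> * t + \<delta>)"
  obtain N D where "rational_rep UNIV \<phi> N D" using birational by (auto simp: birational_on_def)
  then have N: "polynomial_function N" and D: "real_polynomial_function D" and "\<exists>v. D v \<noteq> 0"
    and \<phi>: "\<And>v. D v \<noteq> 0 \<Longrightarrow> \<phi> v = N v /\<^sub>R D v"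
    by (auto simp: rational_rep_def)
  then obtain v0 where D0: "D v0 \<noteq> 0" by blast
  have snd_N: "real_polynomial_function (\<lambda>v. snd (N v))"
    using bounded_linear_compose_polynomial_function[OF bounded_linear_snd N] .
  define G where "G v \<longleftrightarrow> f (x v) = x (\<phi> v) \<and> D v \<noteq> 0 \<and> \<gamma> * fst v + \<delta> \<noteq> 0 \<and> fst (\<phi> v) = ?\<psi> (fst v)" for v
  have gen: "generically UNIV G"
    unfolding G_def
    by (intro generically_plane_conj commute generically_poly_function_neq_0[OF D D0] moebius)
  have diff: "(s1 - s2) *\<^sub>R (Q *v dir t) = (snd (\<phi> (t, s1)) - snd (\<phi> (t, s2))) *\<^sub>R dir (?\<psi> t)"
    if "G (t, s1)" "G (t, s2)" for t s1 s2
  proof -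
    have \<phi>_eq: "\<phi> (t, s1) = (?\<psi> t, snd (\<phi> (t, s1)))" "\<phi> (t, s2) = (?\<psi> t, snd (\<phi> (t, s2)))"
      using that by (auto simp: G_def prod_eq_iff)
    have "f (x (t, s1)) - f (x (t, s2)) = x (?\<psi> t, snd (\<phi> (t, s1))) - x (?\<psi> t, snd (\<phi> (t, s2)))"
      using that \<phi>_eq unfolding G_def by metis
    moreover have "f (x (t, s1)) - f (x (t, s2)) = (s1 - s2) *\<^sub>R (Q *v dir t)"
      by (simp add: f_eq isometry_map_def ruled_map_def dir_def matrix_vector_right_distrib
          matrix_vector_mult_scaleR scaleR_left_diff_distrib)
    moreover have "x (t, s1) - x (t, s2) = (s1 - s2) *\<^sub>R dir t" for t s1 s2
      by (simp add: ruled_map_def dir_def scaleR_left_diff_distrib)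
    ultimately show ?thesis by simp
  qed
  have "MOST t. \<gamma> * t + \<delta> \<noteq> 0 \<and> (\<exists>a. Q *v dir t = a *\<^sub>R dir (?\<psi> t))"
    using generically_planeD(1)[OF gen]
  proof eventually_elim
    case (elim t)
    then obtain s1 where s1: "G (t, s1)" by (blast dest: MOST_real_ex)
    have "MOST s. G (t, s) \<and> s \<noteq> s1" using elim by (simp add: MOST_conj_distrib)
    then obtain s2 where s2: "G (t, s2)" "s2 \<noteq> s1" by (blast dest: MOST_real_ex)
    have "inverse (s1 - s2) *\<^sub>R (s1 - s2) *\<^sub>R (Q *v dir t) =
        inverse (s1 - s2) *\<^sub>R (snd (\<phi> (t, s1)) - snd (\<phi> (t, s2))) *\<^sub>R dir (?\<psi> t)"
      by (simp only: diff[OF s1 s2(1)])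
    then have "Q *v dir t =
        (inverse (s1 - s2) * (snd (\<phi> (t, s1)) - snd (\<phi> (t, s2)))) *\<^sub>R dir (?\<psi> t)"
      using s2(2) by simp
    then show ?case using s1 by (auto simp: G_def)
  qed
  note hom = homogeneous_direction[OF assms(1,2) Q_Q this[unfolded dir_def], folded dir_def]
  obtain k where k: "MOST t. Q *v dir t = (k * (\<gamma> * t + \<delta>) ^ n) *\<^sub>R dir (?\<psi> t)" using hom(1) by blast
  obtain s0 where s0: "MOST t. G (t, s0)" using generically_planeD(2)[OF gen] by blast
  obtain C where C: "\<And>t. snd (N (t, s0)) = poly C t"
    using real_polynomial_function_plane[OF snd_N] by blast
  obtain B where B: "\<And>t. D (t, s0) = poly B t"
    using real_polynomial_function_plane[OF D] by blast
  \<comment> \<open>With this choice \<open>R / B\<close> is the second component of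
    \<open>\<phi>\<close> at \<open>s0\<close> minus the linear term there, so it serves as
    \<open>c\<close>.\<close>
  define R where "R = C - smult (k * s0) ([:\<delta>, \<gamma>:] ^ n) * B"
  \<comment> \<open>The formula is first obtained only for almost all \<open>t\<close> and then
    almost all \<open>s\<close>. As a polynomial identity it extends to the plane and so yields a
    generic statement.\<close>
  define g where "g v = snd (N v) * poly B (fst v) -
    (poly (smult k ([:\<delta>, \<gamma>:] ^ n)) (fst v) * snd v * poly B (fst v) + poly R (fst v)) * D v" for v
  have g: "real_polynomial_function g"
    unfolding g_def
    by (intro real_polynomial_function_diff real_polynomial_function.intros(3,4) snd_N D
        real_polynomial_function_poly_compose real_polynomial_function_fst real_polynomial_function_snd)
  have "MOST t. MOST s. g (t, s) = 0"
    using generically_planeD(1)[OF gen] k s0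
  proof eventually_elim
    case (elim t)
    note elim' = elim
    show ?case using elim(1)
    proof eventually_elim
      case (elim s)
      have "(snd (\<phi> (t, s)) - snd (\<phi> (t, s0)) - (s - s0) * (k * (\<gamma> * t + \<delta>) ^ n)) *\<^sub>R dir (?\<psi> t) = 0"
        using diff[OF elim elim'(3)] elim'(2) by (simp add: scaleR_left_diff_distrib)
      then have *: "snd (\<phi> (t, s)) - snd (\<phi> (t, s0)) = (s - s0) * (k * (\<gamma> * t + \<delta>) ^ n)"
        using hom(2) by simp
      have Ds: "D (t, s) \<noteq> 0" "poly B t \<noteq> 0" using elim elim'(3) by (auto simp: G_def B)
      then have N_eq: "snd (N (t, s)) = snd (\<phi> (t, s)) * D (t, s)" "poly C t = snd (\<phi> (t, s0)) * poly B t"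
        using \<phi>[of "(t, s)"] \<phi>[of "(t, s0)"] C[of t] B[of t] by (simp_all add: field_simps)
      have "g (t, s) = (snd (\<phi> (t, s)) - snd (\<phi> (t, s0)) - (s - s0) * (k * (\<gamma> * t + \<delta>) ^ n)) *
          D (t, s) * poly B t"
        by (simp add: g_def R_def N_eq algebra_simps)
      then show "g (t, s) = 0" using * by simp
    qed
  qed
  then have "MOST t. INFM s. g (t, s) = 0"
    by (rule eventually_mono) (rule MOST_INFM[OF infinite_UNIV_char_0])
  then have "INFM t. INFM s. g (t, s) = 0" by (rule MOST_INFM[OF infinite_UNIV_char_0])
  then have g0: "g v = 0" for v by (rule poly_function_plane_eq_0[OF g])
  obtain t0 where "G (t0, s0)" using s0 by (blast dest: MOST_real_ex)
  then have "poly B t0 \<noteq> 0" by (simp add: G_def B)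
  then have "generically UNIV (\<lambda>v::real \<times> real. poly B (fst v) \<noteq> 0)"
    by (intro generically_poly_function_neq_0[where v = "(t0, s0)"])
      (auto intro: real_polynomial_function_poly_compose real_polynomial_function_fst)
  from generically_plane_conj[OF this gen]
  have "generically UNIV (\<lambda>v. \<gamma> * fst v + \<delta> \<noteq> 0 \<and>
    \<phi> v = (?\<psi> (fst v), k * (\<gamma> * fst v + \<delta>) ^ n * snd v + rf_eval (Fract R B) (fst v)))"
  proof (rule generically_mono)
    fix v assume v: "poly B (fst v) \<noteq> 0 \<and> G v"
    have Gv: "D v \<noteq> 0" "\<gamma> * fst v + \<delta> \<noteq> 0" "fst (\<phi> v) = ?\<psi> (fst v)" and Bv: "poly B (fst v) \<noteq> 0"
      using v unfolding G_def by blast+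
    have "snd (\<phi> v) = snd (N v) / D v" by (simp add: \<phi>[OF Gv(1)] divide_inverse mult.commute)
    moreover have "snd (N v) * poly B (fst v) =
        (k * (\<gamma> * fst v + \<delta>) ^ n * snd v * poly B (fst v) + poly R (fst v)) * D v"
      using g0[of v] by (simp add: g_def algebra_simps)
    ultimately have "snd (\<phi> v) =
        (k * (\<gamma> * fst v + \<delta>) ^ n * snd v * poly B (fst v) + poly R (fst v)) / poly B (fst v)"
      using frac_eq_eq[OF Gv(1) Bv, of "snd (N v)"] by metis
    then have "snd (\<phi> v) = k * (\<gamma> * fst v + \<delta>) ^ n * snd v + rf_eval (Fract R B) (fst v)"
      using Bv by (simp add: rf_Fract(2) add_divide_distrib)
    with Gv show "\<gamma> * fst v + \<delta> \<noteq> 0 \<and>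
        \<phi> v = (?\<psi> (fst v), k * (\<gamma> * fst v + \<delta>) ^ n * snd v + rf_eval (Fract R B) (fst v))"
      by (simp add: prod_eq_iff)
  qed
  then show ?thesis by blast
qed

text \<open>The coefficient of \<open>s\<close> in \<open>\<phi> (\<phi> v) = v\<close> must be 1.
  In it the two powers combine to a power of the denominator of
  \<open>\<psi> \<circ> \<psi>\<close>.\<close>

lemma scale_factor:
  assumes form: "generically UNIV (\<lambda>v. \<gamma> * fst v + \<delta> \<noteq> 0 \<and>
    \<phi> v = ((\<alpha> * fst v + \<beta>) / (\<gamma> * fst v + \<delta>), k * (\<gamma> * fst v + \<delta>) ^ n * snd v + rf_eval c (fst v)))"
  shows "\<exists>t. k\<^sup>2 * (\<gamma> * (\<alpha> + \<delta>) * t + (\<gamma> * \<beta> + \<delta>\<^sup>2)) ^ n = 1"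
proof -
  let ?\<psi> = "\<lambda>t. (\<alpha> * t + \<beta>) / (\<gamma> * t + \<delta>)"
  have "generically UNIV (\<lambda>v. (\<gamma> * fst v + \<delta> \<noteq> 0 \<and>
      \<phi> v = (?\<psi> (fst v), k * (\<gamma> * fst v + \<delta>) ^ n * snd v + rf_eval c (fst v))) \<and>
    (\<gamma> * fst (\<phi> v) + \<delta> \<noteq> 0 \<and>
      \<phi> (\<phi> v) = (?\<psi> (fst (\<phi> v)), k * (\<gamma> * fst (\<phi> v) + \<delta>) ^ n * snd (\<phi> v) + rf_eval c (fst (\<phi> v)))) \<and>
    \<phi> (\<phi> v) = v)"
    by (intro generically_plane_conj form \<phi>_involution generically_compose_birational[OF birational form])
  then have "generically UNIV (\<lambda>v. \<gamma> * fst v + \<delta> \<noteq> 0 \<and> snd v = k * (\<gamma> * ?\<psi> (fst v) + \<delta>) ^ n *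
      (k * (\<gamma> * fst v + \<delta>) ^ n * snd v + rf_eval c (fst v)) + rf_eval c (?\<psi> (fst v)))"
    by (rule generically_mono) (metis fst_conv snd_conv)
  then have most: "MOST t. MOST s. \<gamma> * t + \<delta> \<noteq> 0 \<and> s = k * (\<gamma> * ?\<psi> t + \<delta>) ^ n *
      (k * (\<gamma> * t + \<delta>) ^ n * s + rf_eval c t) + rf_eval c (?\<psi> t)"
    using generically_planeD(1) by fastforce
  obtain t where t: "MOST s. \<gamma> * t + \<delta> \<noteq> 0 \<and> s = k * (\<gamma> * ?\<psi> t + \<delta>) ^ n *
      (k * (\<gamma> * t + \<delta>) ^ n * s + rf_eval c t) + rf_eval c (?\<psi> t)"
    using MOST_real_ex[OF most] by blast
  define m where "m = k * (\<gamma> * ?\<psi> t + \<delta>) ^ n * (k * (\<gamma> * t + \<delta>) ^ n)"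
  have "MOST s. poly [:0, 1:] s = poly [:k * (\<gamma> * ?\<psi> t + \<delta>) ^ n * rf_eval c t + rf_eval c (?\<psi> t), m:] s"
    using t by (rule eventually_mono) (simp add: m_def algebra_simps)
  then have "[:0, 1:] = [:k * (\<gamma> * ?\<psi> t + \<delta>) ^ n * rf_eval c t + rf_eval c (?\<psi> t), m:]"
    by (rule poly_eq_if_MOST)
  then have "m = 1" by simp
  have den: "\<gamma> * t + \<delta> \<noteq> 0" using MOST_real_ex[OF t] by blast
  have "m = k\<^sup>2 * ((\<gamma> * ?\<psi> t + \<delta>) * (\<gamma> * t + \<delta>)) ^ n"
    by (simp add: m_def power_mult_distrib power2_eq_square)
  also have "(\<gamma> * ?\<psi> t + \<delta>) * (\<gamma> * t + \<delta>) = \<gamma> * (\<alpha> * t + \<beta>) + \<delta> * (\<gamma> * t + \<delta>)"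
    using den by (simp add: distrib_right)
  also have "\<dots> = \<gamma> * (\<alpha> + \<delta>) * t + (\<gamma> * \<beta> + \<delta>\<^sup>2)"
    by (simp add: algebra_simps power2_eq_square)
  finally show ?thesis using \<open>m = 1\<close> by metis
qed

end

theorem theorem8:
  fixes S :: "(real ^ 3) set"
    and p :: "real poly fract ^ 3"
    and q :: "real poly ^ 3"
    and n :: nat
    and Q :: "real ^ 3 ^ 3"
    and b :: "real ^ 3"
    and f :: "real ^ 3 \<Rightarrow> real ^ 3"
    and \<phi> :: "real \<times> real \<Rightarrow> real \<times> real"
  assumes "proper_ruled_parametrization S p q"
    and "gcd (q $ 1) (gcd (q $ 2) (q $ 3)) = 1"
    and "\<not> doubly_ruled S"
    and "\<not> cylindrical q"
    and "\<not> surface_of_revolution S"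
    and "n = max (degree (q $ 1)) (max (degree (q $ 2)) (degree (q $ 3)))"
    and "orthogonal_matrix Q"
    and "f = isometry_map Q b"
    and "symmetry_of S f"
    and "f \<circ> f = id"
    and "birational_on UNIV UNIV \<phi>"
    and "generically UNIV (\<lambda>z. f (ruled_map p q z) = ruled_map p q (\<phi> z))"
  shows "\<exists>(\<alpha>::real) (\<beta>::real) (\<gamma>::real) (\<delta>::real) (k::real) (c::real poly fract).
           \<alpha> * \<delta> - \<beta> * \<gamma> \<noteq> 0 \<and>
           generically UNIV (\<lambda>(t, s).
             \<phi> (t, s) = ((\<alpha> * t + \<beta>) / (\<gamma> * t + \<delta>), k * (\<gamma> * t + \<delta>) ^ n * s + rf_eval c t)) \<and>
           ((\<alpha> = - \<delta> \<and> k\<^sup>2 * (\<gamma> * \<beta> + \<delta>\<^sup>2) ^ n = 1) \<or>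
            (\<beta> = 0 \<and> \<gamma> = 0 \<and> k\<^sup>2 * \<delta> ^ (2 * n) = 1 \<and> \<alpha> = \<delta> \<and> \<delta> \<noteq> 0))"
proof -
  interpret ruled_involution S p q Q b f \<phi>
    using assms by unfold_locales (simp_all add: symmetry_of_def)
  obtain \<alpha> \<beta> \<gamma> \<delta> where det: "\<alpha> * \<delta> - \<beta> * \<gamma> \<noteq> 0"
    and cases: "\<alpha> = - \<delta> \<or> \<beta> = 0 \<and> \<gamma> = 0 \<and> \<alpha> = \<delta> \<and> \<delta> \<noteq> 0"
    and "generically UNIV (\<lambda>v. \<gamma> * fst v + \<delta> \<noteq> 0 \<and> fst (\<phi> v) = (\<alpha> * fst v + \<beta>) / (\<gamma> * fst v + \<delta>))"
    using fst_\<phi>_moebius by blast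
  then obtain k c where form: "generically UNIV (\<lambda>v. \<gamma> * fst v + \<delta> \<noteq> 0 \<and>
    \<phi> v = ((\<alpha> * fst v + \<beta>) / (\<gamma> * fst v + \<delta>), k * (\<gamma> * fst v + \<delta>) ^ n * snd v + rf_eval c (fst v)))"
    using \<phi>_form[OF assms(2,6)] by blast
  obtain t where t: "k\<^sup>2 * (\<gamma> * (\<alpha> + \<delta>) * t + (\<gamma> * \<beta> + \<delta>\<^sup>2)) ^ n = 1"
    using scale_factor[OF form] by blast
  have "generically UNIV (\<lambda>(t, s).
      \<phi> (t, s) = ((\<alpha> * t + \<beta>) / (\<gamma> * t + \<delta>), k * (\<gamma> * t + \<delta>) ^ n * s + rf_eval c t))"
    using form by (rule generically_mono) auto
  \<comment> \<open>Either \<open>\<alpha> + \<delta> = 0\<close> or \<open>\<gamma> = 0\<close>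
    removes the term with \<open>t\<close>, so a single value of \<open>t\<close> suffices.\<close>
  moreover have "(\<alpha> = - \<delta> \<and> k\<^sup>2 * (\<gamma> * \<beta> + \<delta>\<^sup>2) ^ n = 1) \<or>
      (\<beta> = 0 \<and> \<gamma> = 0 \<and> k\<^sup>2 * \<delta> ^ (2 * n) = 1 \<and> \<alpha> = \<delta> \<and> \<delta> \<noteq> 0)"
    using cases t by (auto simp: power_mult)
  ultimately show ?thesis using det by blast
qed

end
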